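(* Let $A=\mathbb{F}_q[T]$, where $q$ is a power of a prime $p$. Let $j$ be a nonnegative integer with associated special polynomial $z(x,-j)$, and let $\rho_\ast\in S_{(q)}$. Then $z(x,-j)$ and $z(x,-\rho_\ast(j))$ have the same degree in $x^{-1}$.
   Context: For $A=\mathbb{F}_q[T]$ and a nonnegative integer $j$, the special polynomial is $z(x,-j):=\sum_{e=0}^\infty x^{-e}\Big(\sum_{f} f^{\,j}\Big)$, where the inner sum is over monic $f\in A$ of degree $e$; it is known that the inner sum vanishes for $e$ large, so $z(x,-j)$ is a polynomial in $x^{-1}$ with coefficients in $A$. $S_{(q)}$: for a permutation $\rho$ of $\{0,1,2,\dots\}$ and $x=\sum_{i\ge0}c_iq^i\in\mathbb{Z}_p$ with $0\le c_i<q$, put $\rho_\ast(x)=\sum_{i\ge0}c_iq^{\rho(i)}$; $S_{(q)}$ is the group of all bijections $\rho_\ast$ of $\mathbb{Z}_p$. These permute the nonnegative integers. *)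

theory Defs
  imports
    "HOL-Computational_Algebra.Polynomial"
    "HOL-Library.Groups_Big_Fun"
    "HOL-Library.FuncSet"
    "HOL-Library.Cardinality"
    "HOL-Computational_Algebra.Primes"
begin

definition monic_polys :: "nat \<Rightarrow> 'a::field poly set" where
  "monic_polys e = {f. lead_coeff f = 1 \<and> degree f = e}"

definition power_sum :: "nat \<Rightarrow> nat \<Rightarrow> 'a::field poly" where
  "power_sum e j = (\<Sum>f\<in>monic_polys e. f ^ j)"

text \<open>
  The polynomial variable of the outer \<open>poly\<close> stands for \<open>x\<inverse>\<close>, so
  \<open>degree (special_poly j)\<close> is the degree in \<open>x\<inverse>\<close>. \<open>Sum_any\<close> is the sum over all
  \<open>e\<close>; only finitely many summands are nonzero when the field is finite, see
  \<open>power_sum_eq_0\<close> below.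
\<close>

definition special_poly :: "nat \<Rightarrow> 'a::field poly poly" where
  "special_poly j = Sum_any (\<lambda>e. monom (power_sum e j) e)"

text \<open>
  \<open>\<int>\<^sub>p\<close> as the inverse limit of the rings \<open>\<int>/p\<^sup>n\<close>: the \<open>n\<close>-th component of \<open>x\<close> is the
  representative of \<open>x\<close> modulo \<open>p\<^sup>n\<close> in \<open>{0..<p\<^sup>n}\<close>.
\<close>

definition padic_ints :: "nat \<Rightarrow> (nat \<Rightarrow> nat) set" where
  "padic_ints p = {x. \<forall>n. x n < p ^ n \<and> x (Suc n) mod p ^ n = x n}"

definition padic_of_nat :: "nat \<Rightarrow> nat \<Rightarrow> (nat \<Rightarrow> nat)" where
  "padic_of_nat p k = (\<lambda>n. k mod p ^ n)"

text \<open>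
  The \<open>p\<close>-adic sum of a series of natural numbers whose terms tend \<open>p\<close>-adically to \<open>0\<close>:
  modulo \<open>p\<^sup>n\<close> only the finitely many terms not divisible by \<open>p\<^sup>n\<close> contribute.
\<close>

definition padic_suminf :: "nat \<Rightarrow> (nat \<Rightarrow> nat) \<Rightarrow> (nat \<Rightarrow> nat)" where
  "padic_suminf p a = (\<lambda>n. (\<Sum>i | \<not> p ^ n dvd a i. a i) mod p ^ n)"

definition padic_digits :: "nat \<Rightarrow> nat \<Rightarrow> (nat \<Rightarrow> nat) \<Rightarrow> (nat \<Rightarrow> nat)" where
  "padic_digits p q x =
     (THE c. (\<forall>i. c i < q) \<and> x = padic_suminf p (\<lambda>i. c i * q ^ i))"

definition digit_perm :: "nat \<Rightarrow> nat \<Rightarrow> (nat \<Rightarrow> nat) \<Rightarrow> (nat \<Rightarrow> nat) \<Rightarrow> (nat \<Rightarrow> nat)" where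
  "digit_perm p q \<rho> =
     (\<lambda>x\<in>padic_ints p. padic_suminf p (\<lambda>i. padic_digits p q x i * q ^ \<rho> i))"

definition digit_perms :: "nat \<Rightarrow> nat \<Rightarrow> ((nat \<Rightarrow> nat) \<Rightarrow> (nat \<Rightarrow> nat)) set" where
  "digit_perms p q = {digit_perm p q \<rho> |\<rho>. bij \<rho>}"

text \<open>The map induced on the nonnegative integers; see \<open>digit_perm_of_nat\<close> below.\<close>

definition nat_action :: "nat \<Rightarrow> ((nat \<Rightarrow> nat) \<Rightarrow> (nat \<Rightarrow> nat)) \<Rightarrow> nat \<Rightarrow> nat" where
  "nat_action p \<sigma> j = inv (padic_of_nat p) (\<sigma> (padic_of_nat p j))"


subsection \<open>Well-definedness of the special polynomials\<close>

lemma of_nat_CARD_eq_0: "of_nat (CARD('a)) = (0 :: 'a::{field, finite})"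
proof -
  have "(\<Sum>a\<in>UNIV. a) = (\<Sum>a\<in>UNIV. a + (1 :: 'a))"
    by (rule sum.reindex_bij_betw[symmetric]) (rule bij_plus_right)
  thus ?thesis by (simp add: sum.distrib)
qed

definition polys_below :: "nat \<Rightarrow> 'a::field poly set" where
  "polys_below e = {h. \<forall>i\<ge>e. coeff h i = 0}"

lemma polys_below_0: "polys_below 0 = {0}"
  by (auto simp: polys_below_def poly_eq_iff)

lemma polys_below_Suc:
  "polys_below (Suc e) = (\<lambda>(a, h). monom a e + h) ` (UNIV \<times> polys_below e)"
proof (intro equalityI subsetI)
  fix f :: "'a poly" assume f: "f \<in> polys_below (Suc e)"
  have "f - monom (coeff f e) e \<in> polys_below e"
    unfolding polys_below_def
  proof (intro CollectI allI impI)
    fix i assume "e \<le> i"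
    thus "coeff (f - monom (coeff f e) e) i = 0"
      using f by (cases "i = e") (auto simp: polys_below_def)
  qed
  moreover have "f = monom (coeff f e) e + (f - monom (coeff f e) e)" by simp
  ultimately show "f \<in> (\<lambda>(a, h). monom a e + h) ` (UNIV \<times> polys_below e)"
    by (intro image_eqI[where x = "(coeff f e, f - monom (coeff f e) e)"]) auto
qed (auto simp: polys_below_def)

lemma inj_on_polys_below_Suc:
  "inj_on (\<lambda>(a, h). monom a e + h) (UNIV \<times> polys_below e)"
proof (rule inj_onI, clarsimp)
  fix a b :: 'a and h k :: "'a poly"
  assume hk: "h \<in> polys_below e" "k \<in> polys_below e" and eq: "monom a e + h = monom b e + k"
  have "coeff (monom a e + h) e = coeff (monom b e + k) e" by (simp add: eq)
  hence "a = b" using hk by (simp add: polys_below_def)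
  thus "a = b \<and> h = k" using eq by simp
qed

lemma finite_polys_below: "finite (polys_below e :: 'a::{field, finite} poly set)"
  by (induction e) (simp_all add: polys_below_0 polys_below_Suc)

lemma sum_polys_below_power:
  fixes g :: "'a::{field, finite} poly"
  shows "j < e \<Longrightarrow> (\<Sum>h\<in>polys_below e. (g + h) ^ j) = 0"
proof (induction e arbitrary: j g)
  case (Suc e)
  have const: "(\<Sum>h\<in>polys_below e. (g' + h) ^ j) = (\<Sum>h\<in>polys_below e. h ^ j)"
    for g' :: "'a poly"
  proof -
    have "(\<Sum>h\<in>polys_below e. (g' + h) ^ j)
        = (\<Sum>h\<in>polys_below e. \<Sum>k\<le>j. of_nat (j choose k) * h ^ k * g' ^ (j - k))"
      by (subst add.commute, subst binomial_ring) (rule refl)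
    also have "\<dots> = (\<Sum>k\<le>j. \<Sum>h\<in>polys_below e. of_nat (j choose k) * h ^ k * g' ^ (j - k))"
      by (rule sum.swap)
    also have "\<dots> = (\<Sum>k\<le>j. of_nat (j choose k) * (\<Sum>h\<in>polys_below e. h ^ k) * g' ^ (j - k))"
      by (simp add: sum_distrib_left sum_distrib_right)
    also have "\<dots> = (\<Sum>k\<in>{j}. of_nat (j choose k) * (\<Sum>h\<in>polys_below e. h ^ k) * g' ^ (j - k))"
    proof (rule sum.mono_neutral_right)
      show "\<forall>k\<in>{..j} - {j}.
          of_nat (j choose k) * (\<Sum>h\<in>polys_below e. h ^ k) * g' ^ (j - k) = 0"
      proof
        fix k assume "k \<in> {..j} - {j}"
        hence "k < e" using Suc.prems by auto
        from Suc.IH[OF this, of 0]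
        show "of_nat (j choose k) * (\<Sum>h\<in>polys_below e. h ^ k) * g' ^ (j - k) = 0" by simp
      qed
    qed auto
    finally show ?thesis by simp
  qed
  have "(\<Sum>h\<in>polys_below (Suc e). (g + h) ^ j)
      = (\<Sum>(a, h)\<in>UNIV \<times> polys_below e. ((g + monom a e) + h) ^ j)"
    unfolding polys_below_Suc
    by (subst sum.reindex[OF inj_on_polys_below_Suc]) (simp add: case_prod_unfold add.assoc)
  also have "\<dots> = (\<Sum>a\<in>(UNIV::'a set). \<Sum>h\<in>polys_below e. ((g + monom a e) + h) ^ j)"
    by (rule sum.cartesian_product[symmetric])
  also have "\<dots> = of_nat (CARD('a)) * (\<Sum>h\<in>polys_below e. h ^ j)"
    by (simp add: const)
  also have "of_nat (CARD('a)) = (0 :: 'a poly)"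
    by (simp add: of_nat_poly of_nat_CARD_eq_0)
  finally show ?case by simp
qed simp

lemma monic_polys_eq: "monic_polys e = (\<lambda>h. monom 1 e + h) ` polys_below e"
proof (intro equalityI subsetI)
  fix f :: "'a poly" assume f: "f \<in> monic_polys e"
  have "f - monom 1 e \<in> polys_below e"
    unfolding polys_below_def
  proof (intro CollectI allI impI)
    fix i assume "e \<le> i"
    thus "coeff (f - monom 1 e) i = 0"
      using f by (cases "i = e") (auto simp: monic_polys_def coeff_eq_0)
  qed
  thus "f \<in> (\<lambda>h. monom 1 e + h) ` polys_below e"
    by (intro image_eqI[where x = "f - monom 1 e"]) auto
next
  fix f :: "'a poly" assume "f \<in> (\<lambda>h. monom 1 e + h) ` polys_below e"
  then obtain h where h: "h \<in> polys_below e" "f = monom 1 e + h" by auto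
  have c: "coeff f e = 1" using h by (simp add: polys_below_def)
  have "degree f \<le> e"
    using h by (intro degree_le) (auto simp: polys_below_def)
  moreover have "degree f \<ge> e" by (rule le_degree) (simp add: c)
  ultimately show "f \<in> monic_polys e" using c by (simp add: monic_polys_def)
qed

lemma finite_monic_polys: "finite (monic_polys e :: 'a::{field, finite} poly set)"
  by (simp add: monic_polys_eq finite_polys_below)

lemma power_sum_eq_0:
  assumes "j < e"
  shows "(power_sum e j :: 'a::{field, finite} poly) = 0"
  unfolding power_sum_def monic_polys_eq
  by (subst sum.reindex) (simp_all add: sum_polys_below_power[OF assms])

lemma coeff_special_poly:
  "coeff (special_poly j :: 'a::{field, finite} poly poly) e = power_sum e j"
proof -
  let ?S = "{e. monom (power_sum e j :: 'a poly) e \<noteq> 0}"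
  have fin: "finite ?S"
    by (rule finite_subset[of _ "{..j}"]) (auto intro: ccontr simp: power_sum_eq_0 not_le[symmetric])
  have "coeff (special_poly j :: 'a poly poly) e
      = (\<Sum>d\<in>?S. coeff (monom (power_sum d j :: 'a poly) d) e)"
    by (simp only: special_poly_def Sum_any.expand_set coeff_sum)
  also have "\<dots> = (\<Sum>d\<in>?S. if d = e then power_sum d j else 0)"
    by (intro sum.cong) auto
  also have "\<dots> = power_sum e j" using fin by (simp add: sum.delta')
  finally show ?thesis .
qed


subsection \<open>Well-definedness of the digit permutations\<close>

lemma add_dvd_mod:
  fixes a b c :: nat
  assumes "c dvd b"
  shows "(a + b) mod c = a mod c"
  using assms by auto

lemma padic_suminf_digits:
  assumes "prime p" "q = p ^ m" "1 < q" "inj \<rho>"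
    and "N \<supseteq> {i. \<rho> i < n}" "finite N"
  shows "padic_suminf p (\<lambda>i. c i * q ^ \<rho> i) n = (\<Sum>i\<in>N. c i * q ^ \<rho> i) mod p ^ n"
proof -
  have m: "1 \<le> m" using assms(2,3) by (cases m) auto
  have sub: "{i. \<not> p ^ n dvd c i * q ^ \<rho> i} \<subseteq> N"
  proof
    fix i assume i: "i \<in> {i. \<not> p ^ n dvd c i * q ^ \<rho> i}"
    have "\<rho> i < n"
    proof (rule ccontr)
      assume "\<not> \<rho> i < n"
      hence "n \<le> m * \<rho> i" using m by (metis le_trans mult_le_mono1 mult_1 not_less)
      hence "p ^ n dvd q ^ \<rho> i" by (simp add: assms(2) power_mult[symmetric] le_imp_power_dvd)
      thus False using i by simp
    qed
    thus "i \<in> N" using assms(5) by auto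
  qed
  have "(\<Sum>i\<in>N. c i * q ^ \<rho> i)
      = (\<Sum>i | \<not> p ^ n dvd c i * q ^ \<rho> i. c i * q ^ \<rho> i)
        + (\<Sum>i\<in>N - {i. \<not> p ^ n dvd c i * q ^ \<rho> i}. c i * q ^ \<rho> i)"
    by (subst sum.subset_diff[OF sub assms(6)]) (rule add.commute)
  moreover have "p ^ n dvd (\<Sum>i\<in>N - {i. \<not> p ^ n dvd c i * q ^ \<rho> i}. c i * q ^ \<rho> i)"
    by (rule dvd_sum) auto
  ultimately show ?thesis
    unfolding padic_suminf_def by (simp only: add_dvd_mod)
qed

lemma padic_ints_mod:
  assumes "x \<in> padic_ints p" "n \<le> k"
  shows "x k mod p ^ n = x n"
  using assms(2)
proof (induction k rule: dec_induct)
  case base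
  thus ?case using assms(1) by (simp add: padic_ints_def)
next
  case (step k)
  have "x (Suc k) mod p ^ n = (x (Suc k) mod p ^ k) mod p ^ n"
    using step.hyps by (simp add: mod_mod_cancel le_imp_power_dvd)
  thus ?case using step.IH assms(1) by (simp add: padic_ints_def)
qed

lemma padic_suminf_mem:
  assumes "prime p" "q = p ^ m" "1 < q" "inj \<rho>"
  shows "padic_suminf p (\<lambda>i. c i * q ^ \<rho> i) \<in> padic_ints p"
proof -
  have fin: "finite {i. \<rho> i < n}" for n
    using finite_vimageI[OF finite_lessThan[of n] assms(4)] by (simp add: vimage_def)
  have "padic_suminf p (\<lambda>i. c i * q ^ \<rho> i) n < p ^ n" for n
    using assms(1) by (simp add: padic_suminf_def prime_gt_0_nat)
  moreover have "padic_suminf p (\<lambda>i. c i * q ^ \<rho> i) (Suc n) mod p ^ n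
      = padic_suminf p (\<lambda>i. c i * q ^ \<rho> i) n" for n
    by (subst (1 2) padic_suminf_digits[OF assms, where N = "{i. \<rho> i < Suc n}"])
       (auto simp: fin mod_mod_cancel)
  ultimately show ?thesis by (auto simp: padic_ints_def)
qed

lemma digit_sum_lt:
  fixes q :: nat
  assumes "\<And>i. c i < q"
  shows "(\<Sum>i<k. c i * q ^ i) < q ^ k"
proof (induction k)
  case (Suc k)
  have "(\<Sum>i<Suc k. c i * q ^ i) < (c k + 1) * q ^ k" using Suc by simp
  also have "\<dots> \<le> q * q ^ k" using assms[of k] by (intro mult_le_mono1) simp
  finally show ?case by simp
qed simp

lemma ex1_padic_digits:
  assumes "prime p" "q = p ^ m" "1 < q" "x \<in> padic_ints p"
  shows "\<exists>!c. (\<forall>i. c i < q) \<and> x = padic_suminf p (\<lambda>i. c i * q ^ i)"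
proof -
  have m: "1 \<le> m" using assms(2,3) by (cases m) auto
  have q0: "0 < q" using assms(3) by simp
  have sum_at: "padic_suminf p (\<lambda>i. c i * q ^ i) n = (\<Sum>i<k. c i * q ^ i) mod p ^ n"
    if "n \<le> k" for c n k
    by (rule padic_suminf_digits[OF assms(1-3), where \<rho> = "\<lambda>i. i"]) (use that in auto)
  have pq: "p ^ (m * k) = q ^ k" for k by (simp add: assms(2) power_mult)
  have le: "k \<le> m * k" for k using m by simp
  have sum_q: "padic_suminf p (\<lambda>i. c i * q ^ i) (m * k) = (\<Sum>i<k. c i * q ^ i)"
    if "\<And>i. c i < q" for c k
  proof -
    have "padic_suminf p (\<lambda>i. c i * q ^ i) (m * k) = (\<Sum>i<m * k. c i * q ^ i) mod q ^ k"
      using sum_at[of "m * k" "m * k" c] by (simp add: pq)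
    also have "(\<Sum>i<m * k. c i * q ^ i)
        = (\<Sum>i<k. c i * q ^ i) + (\<Sum>i\<in>{..<m * k} - {..<k}. c i * q ^ i)"
      using le[of k] by (subst sum.subset_diff[of "{..<k}"]) auto
    also have "\<dots> mod q ^ k = (\<Sum>i<k. c i * q ^ i) mod q ^ k"
    proof -
      have "q ^ k dvd (\<Sum>i\<in>{..<m * k} - {..<k}. c i * q ^ i)"
        by (rule dvd_sum) (auto intro!: dvd_mult le_imp_power_dvd)
      thus ?thesis by (rule add_dvd_mod)
    qed
    also have "\<dots> = (\<Sum>i<k. c i * q ^ i)" using digit_sum_lt[of c q k] that by simp
    finally show ?thesis .
  qed
  define d where "d = (\<lambda>i. x (m * Suc i) div q ^ i)"
  have d_lt: "d i < q" for i
  proof -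
    have "x (m * Suc i) < p ^ (m * Suc i)" using assms(4) unfolding padic_ints_def by blast
    hence "x (m * Suc i) < q * q ^ i" by (simp only: pq power_Suc)
    thus ?thesis by (simp add: d_def less_mult_imp_div_less)
  qed
  have d_sum: "(\<Sum>i<k. d i * q ^ i) = x (m * k)" for k
  proof (induction k)
    case 0
    have "x 0 < p ^ 0" using assms(4) unfolding padic_ints_def by blast
    thus ?case by (simp only: sum.lessThan_Suc lessThan_0 sum.empty mult_0_right power_0 less_one)
  next
    case (Suc k)
    have "x (m * Suc k) mod p ^ (m * k) = x (m * k)"
      by (rule padic_ints_mod[OF assms(4)]) simp
    hence "x (m * Suc k) mod q ^ k = x (m * k)" by (simp only: pq)
    moreover have "(\<Sum>i<Suc k. d i * q ^ i) = x (m * k) + x (m * Suc k) div q ^ k * q ^ k"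
      using Suc by (simp only: sum.lessThan_Suc d_def)
    ultimately show ?case by (metis add.commute div_mult_mod_eq)
  qed
  show ?thesis
  proof (rule ex1I[of _ d], intro conjI allI)
    show "d i < q" for i by (rule d_lt)
    show "x = padic_suminf p (\<lambda>i. d i * q ^ i)"
    proof
      fix n
      have "padic_suminf p (\<lambda>i. d i * q ^ i) n = x (m * n) mod p ^ n"
        by (simp add: sum_at[of n n] d_sum)
      also have "\<dots> = x n" by (rule padic_ints_mod[OF assms(4) le])
      finally show "x n = padic_suminf p (\<lambda>i. d i * q ^ i) n" by simp
    qed
  next
    fix c assume c: "(\<forall>i. c i < q) \<and> x = padic_suminf p (\<lambda>i. c i * q ^ i)"
    have s: "(\<Sum>i<k. c i * q ^ i) = (\<Sum>i<k. d i * q ^ i)" for k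
      using sum_q[of c k] c by (metis d_sum)
    show "c = d"
    proof
      fix i
      have "c i * q ^ i = d i * q ^ i" using s[of "Suc i"] s[of i] by simp
      thus "c i = d i" using q0 by simp
    qed
  qed
qed

lemma inj_padic_of_nat:
  assumes "prime p"
  shows "inj (padic_of_nat p)"
proof (rule injI)
  fix a b assume eq: "padic_of_nat p a = padic_of_nat p b"
  have "1 < p" using assms by (rule prime_gt_1_nat)
  hence "(2::nat) ^ (a + b) \<le> p ^ (a + b)" by (intro power_mono) auto
  hence "a < p ^ (a + b)" "b < p ^ (a + b)"
    using less_exp[of "a + b"] by linarith+
  thus "a = b" using fun_cong[OF eq, of "a + b"] by (simp add: padic_of_nat_def)
qed

lemma digit_expansion_nat:
  fixes q :: nat
  shows "(\<Sum>i<k. j div q ^ i mod q * q ^ i) = j mod q ^ k"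
proof (induction k)
  case (Suc k)
  have "j mod (q ^ k * q) = q ^ k * (j div q ^ k mod q) + j mod q ^ k"
    by (rule mod_mult2_eq)
  thus ?case using Suc by (simp only: sum.lessThan_Suc power_Suc mult.commute add.commute)
qed simp

lemma digit_perm_of_nat:
  assumes "prime p" "q = p ^ m" "1 < q" "inj \<rho>"
  shows "digit_perm p q \<rho> (padic_of_nat p j)
       = padic_of_nat p (\<Sum>i\<le>j. (j div q ^ i mod q) * q ^ \<rho> i)"
proof -
  define c where "c = (\<lambda>i. j div q ^ i mod q)"
  have m: "1 \<le> m" using assms(2,3) by (cases m) auto
  have big: "i < q ^ i" for i
  proof -
    have "i < 2 ^ i" by (rule less_exp)
    also have "(2::nat) ^ i \<le> q ^ i" using assms(3) by (intro power_mono) auto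
    finally show ?thesis .
  qed
  have c0: "c i = 0" if "i > j" for i
    using big[of i] that by (simp add: c_def)
  have mem: "padic_of_nat p j \<in> padic_ints p"
    using assms(1) by (auto simp: padic_of_nat_def padic_ints_def prime_gt_0_nat mod_mod_cancel)
  have "padic_of_nat p j = padic_suminf p (\<lambda>i. c i * q ^ i)"
  proof
    fix n
    have "padic_suminf p (\<lambda>i. c i * q ^ i) n = (\<Sum>i<n. c i * q ^ i) mod p ^ n"
      by (rule padic_suminf_digits[OF assms(1-3), where \<rho> = "\<lambda>i. i"]) auto
    also have "\<dots> = j mod q ^ n mod p ^ n" by (simp add: c_def digit_expansion_nat)
    also have "\<dots> = j mod p ^ n"
      using m by (simp add: assms(2) power_mult[symmetric] mod_mod_cancel le_imp_power_dvd)
    finally show "padic_of_nat p j n = padic_suminf p (\<lambda>i. c i * q ^ i) n"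
      by (simp add: padic_of_nat_def)
  qed
  moreover have "c i < q" for i using assms(3) by (simp add: c_def)
  ultimately have "padic_digits p q (padic_of_nat p j) = c"
    unfolding padic_digits_def using ex1_padic_digits[OF assms(1-3) mem] by (intro the1_equality) auto
  hence "digit_perm p q \<rho> (padic_of_nat p j) = padic_suminf p (\<lambda>i. c i * q ^ \<rho> i)"
    using mem by (simp add: digit_perm_def)
  also have "\<dots> = padic_of_nat p (\<Sum>i\<le>j. c i * q ^ \<rho> i)"
  proof
    fix n
    have fin: "finite {i. \<rho> i < n}"
      using finite_vimageI[OF finite_lessThan[of n] assms(4)] by (simp add: vimage_def)
    have "padic_suminf p (\<lambda>i. c i * q ^ \<rho> i) n
        = (\<Sum>i\<in>{i. \<rho> i < n} \<union> {..j}. c i * q ^ \<rho> i) mod p ^ n"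
      by (rule padic_suminf_digits[OF assms]) (auto simp: fin)
    also have "(\<Sum>i\<in>{i. \<rho> i < n} \<union> {..j}. c i * q ^ \<rho> i) = (\<Sum>i\<le>j. c i * q ^ \<rho> i)"
      by (rule sum.mono_neutral_right) (auto simp: fin c0)
    finally show "padic_suminf p (\<lambda>i. c i * q ^ \<rho> i) n
        = padic_of_nat p (\<Sum>i\<le>j. c i * q ^ \<rho> i) n"
      by (simp add: padic_of_nat_def)
  qed
  finally show ?thesis by (simp add: c_def)
qed

lemma nat_action_digit_perm:
  assumes "prime p" "q = p ^ m" "1 < q" "inj \<rho>"
  shows "nat_action p (digit_perm p q \<rho>) j = (\<Sum>i\<le>j. (j div q ^ i mod q) * q ^ \<rho> i)"
  by (simp add: nat_action_def digit_perm_of_nat[OF assms] inv_f_f[OF inj_padic_of_nat[OF assms(1)]])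

end

theory Submission
  imports Defs "HOL-Number_Theory.Cong"
begin

text \<open>
  Write \<open>q = p\<^sup>m\<close> and \<open>\<ell>\<close> for the base-\<open>q\<close> digit sum. The degree of \<open>z(x,-j)\<close> is the minimum over
  \<open>i < m\<close> of \<open>\<lfloor>\<ell>(p\<^sup>i j) / (q - 1)\<rfloor>\<close>, and a permutation of the base-\<open>q\<close> digits of \<open>j\<close> does not change
  any \<open>\<ell>(p\<^sup>i j)\<close>.

  By Lucas' theorem, the \<open>e\<close>-th power sum is a sum of nonzero multiples of \<open>T\<close>-powers over the chains
  \<open>j = k\<^sub>0 > k\<^sub>1 > \<dots> > k\<^sub>e\<close> in which the base-\<open>p\<close> digits decrease and \<open>q - 1\<close> divides every step; the
  exponent is \<open>k\<^sub>1 + \<dots> + k\<^sub>e\<close>. Such a chain forces \<open>e (q - 1) \<le> \<ell>(p\<^sup>i j)\<close> for all \<open>i\<close>, the upper bound.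
  For the lower bound, Frobenius lets us replace \<open>j\<close> by the \<open>p\<^sup>i j\<close> that attains the minimum, and then
  every step has digit sum exactly \<open>q - 1\<close>. The units of the base-\<open>p\<close> digits of \<open>j\<close> become items: one at
  position \<open>n\<close> has class \<open>r = n mod m\<close>, size \<open>p\<^sup>r\<close> and value \<open>p\<^sup>n\<close>, and the steps are bins of capacity
  \<open>q - 1\<close>. Chains with maximal exponent are packings of minimal cost, and an exchange argument shows that
  there is only one, so that the leading term does not cancel.
\<close>

subsection \<open>Optimal packings\<close>

text \<open>Greedy from the largest size down. If more items of the top size exist than fit, they
  fill the target exactly, since their size divides it; otherwise all of them are taken and the
  smaller items cover the remainder.\<close>

lemma subset_sum_powers:
  fixes p :: nat and a :: "nat \<Rightarrow> nat"
  assumes "0 < p" "p ^ r dvd T" "T \<le> (\<Sum>k<r. a k * p ^ k)"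
  shows "\<exists>c. (\<forall>k. c k \<le> a k) \<and> (\<Sum>k<r. c k * p ^ k) = T"
  using assms(2,3)
proof (induction r arbitrary: T)
  case 0
  thus ?case by (intro exI[of _ "\<lambda>_. 0"]) simp
next
  case (Suc r)
  define x where "x = min (a r) (T div p ^ r)"
  define T' where "T' = T - x * p ^ r"
  have dT: "p ^ r dvd T" using Suc.prems(1) by (rule power_le_dvd) simp
  hence Td: "T div p ^ r * p ^ r = T" by simp
  have "x * p ^ r \<le> T div p ^ r * p ^ r" by (simp add: x_def)
  hence le: "x * p ^ r \<le> T" using Td by simp
  have "p ^ r dvd T'" unfolding T'_def using dT by simp
  moreover have "T' \<le> (\<Sum>k<r. a k * p ^ k)"
  proof (cases "a r \<le> T div p ^ r")
    case True
    thus ?thesis using Suc.prems(2) by (simp add: T'_def x_def)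
  next
    case False
    hence "x = T div p ^ r" by (simp add: x_def)
    thus ?thesis by (simp add: T'_def Td)
  qed
  ultimately obtain c where c: "\<forall>k. c k \<le> a k" "(\<Sum>k<r. c k * p ^ k) = T'"
    using Suc.IH by blast
  have "(\<Sum>k<r. (c(r := x)) k * p ^ k) = (\<Sum>k<r. c k * p ^ k)"
    by (intro sum.cong) auto
  thus ?case using c le by (intro exI[of _ "c(r := x)"]) (auto simp: x_def T'_def)
qed

text \<open>\<open>pos r i\<close> is the base-\<open>p\<close> position of the item of index
  \<open>i\<close> in class \<open>r\<close>, counted from the lowest, and \<open>pos_jump\<close>
  encodes that a position holds at most \<open>p - 1\<close> items. Classes are infinite here; the
  available amounts enter through the bound \<open>N\<close> in \<open>chain\<close>.\<close>

locale packing =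
  fixes p m :: nat and pos :: "nat \<Rightarrow> nat \<Rightarrow> nat"
  assumes p_ge_2: "2 \<le> p" and m_pos: "0 < m"
    and pos_mod: "r < m \<Longrightarrow> pos r i mod m = r"
    and pos_mono: "r < m \<Longrightarrow> i \<le> i' \<Longrightarrow> pos r i \<le> pos r i'"
    and pos_jump: "r < m \<Longrightarrow> pos r i < pos r (i + (p - 1))"
begin

definition val :: "nat \<Rightarrow> nat \<Rightarrow> nat" where
  "val r i = p ^ pos r i"

definition weight :: "(nat \<Rightarrow> nat) \<Rightarrow> nat" where
  "weight n = (\<Sum>r<m. \<Sum>i<n r. val r i)"

definition low :: "nat \<Rightarrow> (nat \<Rightarrow> nat) \<Rightarrow> nat" where
  "low r c = (\<Sum>k<r. c k * p ^ k)"

text \<open>In a packing \<open>b\<close>, the bin \<open>s\<close> contains \<open>b s r\<close> items of class \<open>r\<close>. Among equal counts the cheapest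
  choice takes the lowest items of each class, so only the counts matter.\<close>

definition cnt :: "(nat \<Rightarrow> nat \<Rightarrow> nat) \<Rightarrow> nat \<Rightarrow> nat \<Rightarrow> nat" where
  "cnt b t r = (\<Sum>s<t. b s r)"

definition chain :: "nat \<Rightarrow> (nat \<Rightarrow> nat) \<Rightarrow> (nat \<Rightarrow> nat \<Rightarrow> nat) \<Rightarrow> bool" where
  "chain e N b \<longleftrightarrow> (\<forall>s<e. low m (b s) = p ^ m - 1) \<and> (\<forall>r<m. cnt b e r \<le> N r)"

text \<open>With \<open>weight (cnt b t)\<close> in the role of \<open>j - k\<close> for the
  \<open>t\<close>-th exponent \<open>k\<close> of a chain, minimal cost means maximal sum of the
  exponents.\<close>

definition cost :: "nat \<Rightarrow> (nat \<Rightarrow> nat \<Rightarrow> nat) \<Rightarrow> nat" where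
  "cost e b = (\<Sum>t\<in>{1..e}. weight (cnt b t))"

text \<open>The value freed or consumed when an exchange moves the used amount of each class
  \<open>k < r\<close> between \<open>n k\<close> and \<open>n k + c k\<close>.\<close>

definition window :: "nat \<Rightarrow> (nat \<Rightarrow> nat) \<Rightarrow> (nat \<Rightarrow> nat) \<Rightarrow> nat" where
  "window r n c = (\<Sum>k<r. \<Sum>i\<in>{n k..<n k + c k}. val k i)"

section \<open>Values of sets of items\<close>

lemma p_pos: "0 < p" using p_ge_2 by simp

lemma sum_power_lt: "(\<Sum>n<P. (p - 1) * p ^ n) < p ^ P"
proof (induction P)
  case (Suc P)
  have "(\<Sum>n<Suc P. (p - 1) * p ^ n) < p ^ P + (p - 1) * p ^ P" using Suc by simp
  also have "\<dots> = (1 + (p - 1)) * p ^ P" by (simp only: distrib_right mult_1)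
  also have "\<dots> = p ^ Suc P" using p_pos by simp
  finally show ?case .
qed simp

text \<open>Items at one position share a class by \<open>pos_mod\<close>, and their indices lie in
  an interval of length \<open>p - 1\<close> by \<open>pos_jump\<close>.\<close>

lemma card_pos_eq:
  assumes "finite A" "A \<subseteq> {..<m} \<times> UNIV" "\<And>k i. (k, i) \<in> A \<Longrightarrow> pos k i = n"
  shows "card A \<le> p - 1"
proof (cases "A = {}")
  case False
  define r where "r = n mod m"
  have fst: "k = r" if "(k, i) \<in> A" for k i
    using assms(2,3) that pos_mod[of k i] unfolding r_def by auto
  define i0 where "i0 = Min (snd ` A)"
  have i0: "i0 \<in> snd ` A" unfolding i0_def using assms(1) False by simp
  then obtain k0 where k0: "(k0, i0) \<in> A" by auto
  have rm: "r < m" using m_pos by (simp add: r_def)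
  have "A \<subseteq> {r} \<times> {i0..<i0 + (p - 1)}"
  proof (clarify, intro conjI)
    fix k i assume ki: "(k, i) \<in> A"
    show "k \<in> {r}" using fst[OF ki] by simp
    have "i0 \<le> i" unfolding i0_def using ki assms(1) by (intro Min_le) force+
    moreover have "i < i0 + (p - 1)"
    proof (rule ccontr)
      assume "\<not> i < i0 + (p - 1)"
      hence "pos r (i0 + (p - 1)) \<le> pos r i" using pos_mono[OF rm] by simp
      moreover have "pos r i0 < pos r (i0 + (p - 1))" by (rule pos_jump[OF rm])
      moreover have "pos r i0 = n" "pos r i = n"
        using assms(3)[OF k0] assms(3)[OF ki] fst[OF k0] fst[OF ki] by auto
      ultimately show False by simp
    qed
    ultimately show "i \<in> {i0..<i0 + (p - 1)}" by simp
  qed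
  hence "card A \<le> card ({r} \<times> {i0..<i0 + (p - 1)})" by (intro card_mono) auto
  thus ?thesis by (simp add: card_cartesian_product)
qed simp

text \<open>The items at each position act as one base-\<open>p\<close> digit, so the sum is at most
  the number whose \<open>P\<close> digits are all \<open>p - 1\<close>.\<close>

lemma sum_val_lt:
  assumes "finite A" "A \<subseteq> {..<m} \<times> UNIV" "\<And>k i. (k, i) \<in> A \<Longrightarrow> pos k i < P"
  shows "(\<Sum>(k, i)\<in>A. val k i) < p ^ P"
proof -
  have "(\<Sum>(k, i)\<in>A. val k i) = (\<Sum>n<P. \<Sum>x\<in>{x\<in>A. case_prod pos x = n}. case_prod val x)"
    using assms(1,3) by (intro sum.group[symmetric]) auto
  also have "\<dots> \<le> (\<Sum>n<P. (p - 1) * p ^ n)"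
  proof (rule sum_mono)
    fix n
    have "(\<Sum>x\<in>{x\<in>A. case_prod pos x = n}. case_prod val x)
        = (\<Sum>x\<in>{x\<in>A. case_prod pos x = n}. p ^ n)"
      by (intro sum.cong) (auto simp: val_def)
    also have "\<dots> = card {x\<in>A. case_prod pos x = n} * p ^ n" by simp
    also have "\<dots> \<le> (p - 1) * p ^ n"
      using assms(1,2) by (intro mult_le_mono1 card_pos_eq[of _ n]) auto
    finally show "(\<Sum>x\<in>{x\<in>A. case_prod pos x = n}. case_prod val x) \<le> (p - 1) * p ^ n" .
  qed
  also have "\<dots> < p ^ P" by (rule sum_power_lt)
  finally show ?thesis .
qed

lemma window_lt:
  assumes "r \<le> m" "\<And>k i. k < r \<Longrightarrow> n k \<le> i \<Longrightarrow> i < n k + c k \<Longrightarrow> pos k i < P"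
  shows "window r n c < p ^ P"
proof -
  have "window r n c = (\<Sum>(k, i)\<in>(SIGMA k:{..<r}. {n k..<n k + c k}). val k i)"
    unfolding window_def by (rule sum.Sigma) auto
  also have "\<dots> < p ^ P" using assms by (intro sum_val_lt) auto
  finally show ?thesis .
qed

lemma window_mono:
  assumes "r \<le> m" "\<And>k. k < r \<Longrightarrow> n k \<le> n' k"
  shows "window r n c \<le> window r n' c"
  unfolding window_def
proof (intro sum_mono)
  fix k assume k: "k \<in> {..<r}"
  have "(\<Sum>i\<in>{n k..<n k + c k}. val k i) = (\<Sum>i<c k. val k (n k + i))"
    by (subst sum.atLeastLessThan_shift_0) (simp add: atLeast0LessThan)
  also have "\<dots> \<le> (\<Sum>i<c k. val k (n' k + i))"
    unfolding val_def using assms k p_pos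
    by (intro sum_mono power_increasing pos_mono) auto
  also have "\<dots> = (\<Sum>i\<in>{n' k..<n' k + c k}. val k i)"
    by (subst sum.atLeastLessThan_shift_0) (simp add: atLeast0LessThan)
  finally show "(\<Sum>i\<in>{n k..<n k + c k}. val k i) \<le> (\<Sum>i\<in>{n' k..<n' k + c k}. val k i)" .
qed

lemma window_mono_size:
  assumes "\<And>k. k < r \<Longrightarrow> c k \<le> c' k"
  shows "window r n c \<le> window r n c'"
  unfolding window_def using assms
  by (intro sum_mono sum_mono2) auto

lemma val_le_window:
  assumes "k < r" "n k \<le> i" "i < n k + c k"
  shows "val k i \<le> window r n c"
proof -
  have "val k i \<le> (\<Sum>i\<in>{n k..<n k + c k}. val k i)" using assms by (intro member_le_sum) auto
  also have "\<dots> \<le> window r n c" unfolding window_def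
    using assms by (intro member_le_sum[of k "{..<r}" "\<lambda>k. \<Sum>i\<in>{n k..<n k + c k}. val k i"]) auto
  finally show ?thesis .
qed

text \<open>Bookkeeping for trading one item of class \<open>r\<close> against smaller ones. The
  additive form serves both directions of the exchange.\<close>

lemma weight_exchange:
  assumes "r < m" "n' r = Suc (n r)" "\<And>k. k < r \<Longrightarrow> n k = n' k + c k"
    and "\<And>k. r < k \<Longrightarrow> k < m \<Longrightarrow> n' k = n k"
  shows "weight n' + window r n' c = weight n + val r (n r)"
proof -
  have split: "weight x = (\<Sum>k<r. \<Sum>i<x k. val k i) + (\<Sum>i<x r. val r i)
      + (\<Sum>k\<in>{Suc r..<m}. \<Sum>i<x k. val k i)" for x
  proof -
    have "weight x = (\<Sum>k<Suc r. \<Sum>i<x k. val k i) + (\<Sum>k\<in>{Suc r..<m}. \<Sum>i<x k. val k i)"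
      unfolding weight_def lessThan_atLeast0 using assms(1) by (intro sum.atLeastLessThan_concat[symmetric]) auto
    thus ?thesis by simp
  qed
  have low: "(\<Sum>k<r. \<Sum>i<n k. val k i) = (\<Sum>k<r. \<Sum>i<n' k. val k i) + window r n' c"
    unfolding window_def sum.distrib[symmetric]
  proof (intro sum.cong refl)
    fix k assume "k \<in> {..<r}"
    hence e: "n k = n' k + c k" using assms(3) by simp
    show "(\<Sum>i<n k. val k i) = (\<Sum>i<n' k. val k i) + (\<Sum>i\<in>{n' k..<n' k + c k}. val k i)"
      unfolding e lessThan_atLeast0 by (intro sum.atLeastLessThan_concat[symmetric]) auto
  qed
  have high: "(\<Sum>k\<in>{Suc r..<m}. \<Sum>i<n' k. val k i) = (\<Sum>k\<in>{Suc r..<m}. \<Sum>i<n k. val k i)"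
    using assms(4) by (intro sum.cong) auto
  show ?thesis unfolding split[of n] split[of n'] using low high assms(2) by simp
qed

section \<open>Small items in full bins\<close>

lemma low_split:
  assumes "r \<le> R"
  shows "p ^ r dvd low R c - low r c" "low r c \<le> low R c"
proof -
  have "low R c = low r c + (\<Sum>k\<in>{r..<R}. c k * p ^ k)"
    unfolding low_def lessThan_atLeast0 using assms
    by (intro sum.atLeastLessThan_concat[symmetric]) auto
  moreover have "p ^ r dvd (\<Sum>k\<in>{r..<R}. c k * p ^ k)"
    by (rule dvd_sum) (auto intro!: dvd_mult le_imp_power_dvd)
  ultimately show "p ^ r dvd low R c - low r c" "low r c \<le> low R c" by simp_all
qed

lemma low_at:
  assumes "r < m"
  shows "low m c = low r c + c r * p ^ r + (\<Sum>k\<in>{Suc r..<m}. c k * p ^ k)"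
proof -
  have "low m c = (\<Sum>k<Suc r. c k * p ^ k) + (\<Sum>k\<in>{Suc r..<m}. c k * p ^ k)"
    unfolding low_def lessThan_atLeast0 using assms
    by (intro sum.atLeastLessThan_concat[symmetric]) auto
  thus ?thesis by (simp add: low_def)
qed

text \<open>A full bin has size \<open>-1\<close> modulo \<open>p ^ r\<close>, and the classes from
  \<open>r\<close> on contribute multiples of \<open>p ^ r\<close>.\<close>

lemma dvd_low_bin:
  assumes "low m c = p ^ m - 1" "r \<le> m"
  shows "p ^ r dvd low r c + 1"
proof -
  have "p ^ r dvd p ^ m" using assms(2) by (rule le_imp_power_dvd)
  moreover have "(low m c - low r c) + (low r c + 1) = p ^ m"
    using low_split(2)[OF assms(2), of c] assms(1) p_pos one_le_power[of p m] by linarith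
  ultimately show ?thesis using low_split(1)[OF assms(2), of c] by (metis dvd_add_right_iff)
qed

lemma low_bin_ge:
  assumes "low m c = p ^ m - 1" "r \<le> m"
  shows "p ^ r - 1 \<le> low r c"
  using dvd_imp_le[OF dvd_low_bin[OF assms]] by simp

text \<open>The smaller items then have size exactly \<open>p ^ r - 1\<close>, and
  \<open>dvd_low_bin\<close> for \<open>Suc r\<close> turns into
  \<open>p dvd c r + 1\<close>.\<close>

lemma bin_class_ge:
  assumes "low m c = p ^ m - 1" "r < m" "low r c < p ^ r"
  shows "p - 1 \<le> c r"
proof -
  have "low r c + 1 = p ^ r"
    using low_bin_ge[OF assms(1), of r] assms(2,3) by simp
  hence "low (Suc r) c + 1 = (c r + 1) * p ^ r" by (simp add: low_def)
  moreover have "p ^ Suc r dvd low (Suc r) c + 1" using assms by (intro dvd_low_bin) auto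
  ultimately have "p * p ^ r dvd (c r + 1) * p ^ r" by (simp only: power_Suc)
  hence "p dvd c r + 1" using p_pos by (subst (asm) dvd_times_right_cancel_iff) auto
  thus ?thesis using dvd_imp_le[of p "c r + 1"] by simp
qed

section \<open>Exchanges inside one bin\<close>

lemma cnt_upd:
  "cnt (b(s := d)) t k + (if s < t then b s k else 0) = cnt b t k + (if s < t then d k else 0)"
  by (induction t) (auto simp: cnt_def less_Suc_eq)

lemma cnt_mono: "t \<le> t' \<Longrightarrow> cnt b t k \<le> cnt b t' k"
  unfolding cnt_def by (intro sum_mono2) auto

lemma low_cnt: "low r (cnt b t) = (\<Sum>s<t. low r (b s))"
  unfolding low_def cnt_def sum_distrib_right by (rule sum.swap)

text \<open>Geometric growth lets the last term control the sum up to the factor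
  \<open>q / (q - 1)\<close>, here multiplied out.\<close>

lemma geometric_sum_le:
  fixes X :: "nat \<Rightarrow> nat"
  assumes "a \<le> e" "\<And>t. a \<le> t \<Longrightarrow> t < e \<Longrightarrow> q * X t \<le> X (Suc t)" "0 < q"
  shows "(q - 1) * (\<Sum>t\<in>{a..e}. X t) \<le> q * X e"
  using assms(1,2)
proof (induction e rule: dec_induct)
  case (step e)
  have "(q - 1) * (\<Sum>t\<in>{a..Suc e}. X t) = (q - 1) * (\<Sum>t\<in>{a..e}. X t) + (q - 1) * X (Suc e)"
    using step.hyps by (simp add: distrib_left)
  also have "\<dots> \<le> q * X e + (q - 1) * X (Suc e)" using step by simp
  also have "\<dots> \<le> X (Suc e) + (q - 1) * X (Suc e)" using step by simp
  also have "\<dots> = q * X (Suc e)" using assms(3) by (cases q) auto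
  finally show ?case .
qed simp

lemma cost_split:
  assumes "s < e"
  shows "cost e b = (\<Sum>t\<in>{1..s}. weight (cnt b t)) + (\<Sum>t\<in>{Suc s..e}. weight (cnt b t))"
proof -
  have "{1..e} = {1..s} \<union> {Suc s..e}" using assms by auto
  thus ?thesis unfolding cost_def by (simp only:) (subst sum.union_disjoint, auto)
qed

text \<open>The bin to change is the last one with small items of total size \<open>p\<^sup>r\<close>: beyond it every bin
  contains at least \<open>p - 1\<close> items of class \<open>r\<close>, so that the costs of the new item grow geometrically.\<close>

lemma insert_item:
  assumes "chain e N b" "r < m" "s0 < e" "p ^ r \<le> low r (b s0)" "cnt b e r < N r"
  obtains b' c where "chain e N b'" "low r c = p ^ r"
    "cnt b' e r = Suc (cnt b e r)" "\<And>k. k < r \<Longrightarrow> cnt b e k = cnt b' e k + c k"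
    "\<And>k. r < k \<Longrightarrow> cnt b' e k = cnt b e k"
    "(p ^ m - 1) * (cost e b' + window r (cnt b' e) c)
      \<le> (p ^ m - 1) * cost e b + p ^ m * val r (cnt b e r)"
    "\<And>l s. l \<le> r \<Longrightarrow> s < e \<Longrightarrow> (\<forall>k<l. c k = 0) \<Longrightarrow> low l (b' s) = low l (b s)"
proof -
  define s where "s = Max {s. s < e \<and> p ^ r \<le> low r (b s)}"
  have fin: "finite {s. s < e \<and> p ^ r \<le> low r (b s)}" by simp
  have ne: "{s. s < e \<and> p ^ r \<le> low r (b s)} \<noteq> {}" using assms(3,4) by auto
  have s: "s < e" "p ^ r \<le> low r (b s)" using Max_in[OF fin ne] by (auto simp: s_def)
  have later: "low r (b t) < p ^ r" if "s < t" "t < e" for t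
  proof (rule ccontr)
    assume "\<not> low r (b t) < p ^ r"
    hence "t \<le> s" unfolding s_def using that fin by (intro Max_ge) auto
    thus False using that by simp
  qed
  have bin: "low m (b t) = p ^ m - 1" if "t < e" for t using assms(1) that by (simp add: chain_def)
  obtain c where c: "\<And>k. c k \<le> b s k" "low r c = p ^ r"
    using subset_sum_powers[OF p_pos dvd_refl, of r "b s"] s(2) by (auto simp: low_def)
  \<comment> \<open>Bin \<open>s\<close> trades small items of total size \<open>p ^ r\<close> for
    one item of class \<open>r\<close>, which keeps it full.\<close>
  define d where "d k = (if k < r then b s k - c k else if k = r then Suc (b s k) else b s k)" for k
  define b' where "b' = b(s := d)"
  have cnt': "cnt b' t k + (if s < t then b s k else 0) = cnt b t k + (if s < t then d k else 0)" for t k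
    unfolding b'_def by (rule cnt_upd)
  have cnt_before: "cnt b' t k = cnt b t k" if "t \<le> s" for t k using cnt'[of t k] that by simp
  have cnt_low: "cnt b t k = cnt b' t k + c k" if "s < t" "k < r" for t k
    using cnt'[of t k] that c(1)[of k] by (simp add: d_def)
  have cnt_r: "cnt b' t r = Suc (cnt b t r)" if "s < t" for t
    using cnt'[of t r] that by (simp add: d_def)
  have cnt_high: "cnt b' t k = cnt b t k" if "s < t" "r < k" for t k
    using cnt'[of t k] that by (simp add: d_def)
  have low_d: "low m d = low m (b s)"
  proof -
    have "low r (b s) = low r d + low r c"
      unfolding low_def sum.distrib[symmetric] using c(1)
      by (intro sum.cong) (auto simp: d_def distrib_right[symmetric])
    moreover have "(\<Sum>k\<in>{Suc r..<m}. d k * p ^ k) = (\<Sum>k\<in>{Suc r..<m}. b s k * p ^ k)"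
      by (intro sum.cong) (auto simp: d_def)
    ultimately show ?thesis unfolding low_at[OF assms(2), of d] low_at[OF assms(2), of "b s"] using c(2) by (simp add: d_def)
  qed
  have chain: "chain e N b'"
    unfolding chain_def
  proof (intro conjI allI impI)
    fix t assume "t < e" thus "low m (b' t) = p ^ m - 1"
      using bin low_d by (cases "t = s") (auto simp: b'_def)
  next
    fix k assume k: "k < m"
    hence "cnt b e k \<le> N k" using assms(1) by (simp add: chain_def)
    thus "cnt b' e k \<le> N k"
      using cnt_low[OF s(1), of k] cnt_r[OF s(1)] cnt_high[OF s(1), of k] assms(5)
      by (cases k r rule: linorder_cases) auto
  qed
  have ex: "weight (cnt b' t) + window r (cnt b' t) c = weight (cnt b t) + val r (cnt b t r)"
    if "s < t" for t
    using assms(2) cnt_r[OF that] cnt_low[OF that] cnt_high[OF that] by (intro weight_exchange) auto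
  \<comment> \<open>The summand is the price of the new item in prefix \<open>t\<close>. Each later
    bin raises the class count by at least \<open>p - 1\<close>, so the position strictly grows;
    staying in the same residue class modulo \<open>m\<close>, it grows by at least
    \<open>m\<close>.\<close>
  have "(p ^ m - 1) * (\<Sum>t\<in>{Suc s..e}. val r (cnt b t r)) \<le> p ^ m * val r (cnt b e r)"
  proof (rule geometric_sum_le)
    fix t assume t: "Suc s \<le> t" "t < e"
    have "p - 1 \<le> b t r" using t by (intro bin_class_ge bin later assms(2)) auto
    hence "cnt b t r + (p - 1) \<le> cnt b (Suc t) r" by (simp add: cnt_def)
    hence "pos r (cnt b t r) < pos r (cnt b (Suc t) r)"
      using pos_jump[OF assms(2), of "cnt b t r"] pos_mono[OF assms(2)] by (meson less_le_trans)
    moreover have "m dvd pos r (cnt b (Suc t) r) - pos r (cnt b t r)"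
      using pos_mod[OF assms(2)] calculation by (simp add: mod_eq_dvd_iff_nat[symmetric])
    ultimately have "m + pos r (cnt b t r) \<le> pos r (cnt b (Suc t) r)"
      using dvd_imp_le[of m "pos r (cnt b (Suc t) r) - pos r (cnt b t r)"] by simp
    thus "p ^ m * val r (cnt b t r) \<le> val r (cnt b (Suc t) r)"
      unfolding val_def power_add[symmetric] using p_pos by (intro power_increasing) auto
  qed (use s p_pos in auto)
  hence "(p ^ m - 1) * (cost e b + (\<Sum>t\<in>{Suc s..e}. val r (cnt b t r)))
      \<le> (p ^ m - 1) * cost e b + p ^ m * val r (cnt b e r)"
    by (simp only: distrib_left add_left_mono)
  moreover have "cost e b' + window r (cnt b' e) c \<le> cost e b + (\<Sum>t\<in>{Suc s..e}. val r (cnt b t r))"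
  proof -
    have "(\<Sum>t\<in>{Suc s..e}. weight (cnt b' t)) + (\<Sum>t\<in>{Suc s..e}. window r (cnt b' t) c)
      = (\<Sum>t\<in>{Suc s..e}. weight (cnt b t)) + (\<Sum>t\<in>{Suc s..e}. val r (cnt b t r))"
      unfolding sum.distrib[symmetric] using ex by (intro sum.cong) auto
    \<comment> \<open>Of the values freed in the prefixes after \<open>s\<close>, only that in the
      last prefix \<open>e\<close> is retained.\<close>
    moreover have "window r (cnt b' e) c \<le> (\<Sum>t\<in>{Suc s..e}. window r (cnt b' t) c)"
      using s(1) by (intro member_le_sum) auto
    moreover have "(\<Sum>t\<in>{1..s}. weight (cnt b' t)) = (\<Sum>t\<in>{1..s}. weight (cnt b t))"
      by (intro sum.cong refl arg_cong[of _ _ weight] ext cnt_before) auto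
    ultimately show ?thesis unfolding cost_split[OF s(1)] by simp
  qed
  ultimately have cost: "(p ^ m - 1) * (cost e b' + window r (cnt b' e) c)
      \<le> (p ^ m - 1) * cost e b + p ^ m * val r (cnt b e r)"
    by (blast intro: order_trans mult_le_mono2)
  have low: "low l (b' t) = low l (b t)" if "l \<le> r" "\<forall>k<l. c k = 0" for l t
    unfolding low_def b'_def using that by (intro sum.cong) (auto simp: d_def)
  show thesis
  proof (rule that[of b' c])
    show "low l (b' t) = low l (b t)" if "l \<le> r" "t < e" "\<forall>k<l. c k = 0" for l t
      by (rule low[OF that(1,3)])
  qed (fact chain c(2) cost cnt_r[OF s(1)] cnt_low[OF s(1)] cnt_high[OF s(1)])+
qed

text \<open>The reverse exchange: the last bin holding class \<open>r\<close> gives up one item for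
  spare smaller ones of the same total size. These lie below the position of the dearest used item
  of class \<open>r\<close>, so by \<open>window_lt\<close> they are worth less even
  together.\<close>

lemma replace_item:
  assumes "chain e N b" "r < m" "0 < cnt b e r" "low r c = p ^ r"
    and "\<And>k. k < r \<Longrightarrow> cnt b e k + c k \<le> N k"
    and "\<And>k i. k < r \<Longrightarrow> cnt b e k \<le> i \<Longrightarrow> i < cnt b e k + c k \<Longrightarrow> pos k i < pos r (cnt b e r - 1)"
  obtains b' where "chain e N b'" "cost e b' < cost e b"
    "cost e b' + val r (cnt b e r - 1) \<le> cost e b + window r (cnt b e) c"
proof -
  define V where "V = val r (cnt b e r - 1)"
  define s where "s = Max {s. s < e \<and> 0 < b s r}"
  have fin: "finite {s. s < e \<and> 0 < b s r}" by simp
  have ne: "{s. s < e \<and> 0 < b s r} \<noteq> {}" using assms(3) sum.neutral[of "{..<e}" "\<lambda>s. b s r"] by (fastforce simp: cnt_def)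
  have s: "s < e" "0 < b s r" using Max_in[OF fin ne] by (auto simp: s_def)
  have later: "b t r = 0" if "s < t" "t < e" for t
  proof (rule ccontr)
    assume "b t r \<noteq> 0"
    hence "t \<le> s" unfolding s_def using that fin by (intro Max_ge) auto
    thus False using that by simp
  qed
  \<comment> \<open>No bin after \<open>s\<close> uses class \<open>r\<close>, so the item given up
    has index \<open>cnt b e r - 1\<close> in every later prefix.\<close>
  have cnt_e: "cnt b t r = cnt b e r" if "s < t" "t \<le> e" for t
    unfolding cnt_def using that later by (intro sum.mono_neutral_left) auto
  have bin: "low m (b t) = p ^ m - 1" if "t < e" for t using assms(1) that by (simp add: chain_def)
  define d where "d k = (if k < r then b s k + c k else if k = r then b s k - 1 else b s k)" for k
  define b' where "b' = b(s := d)"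
  have cnt': "cnt b' t k + (if s < t then b s k else 0) = cnt b t k + (if s < t then d k else 0)" for t k
    unfolding b'_def by (rule cnt_upd)
  have cnt_before: "cnt b' t k = cnt b t k" if "t \<le> s" for t k using cnt'[of t k] that by simp
  have cnt_low: "cnt b' t k = cnt b t k + c k" if "s < t" "k < r" for t k
    using cnt'[of t k] that by (simp add: d_def)
  have cnt_r: "cnt b t r = Suc (cnt b' t r)" if "s < t" for t
    using cnt'[of t r] that s(2) by (simp add: d_def)
  have cnt_high: "cnt b t k = cnt b' t k" if "s < t" "r < k" for t k
    using cnt'[of t k] that by (simp add: d_def)
  have low_d: "low m d = low m (b s)"
  proof -
    have "low r d = low r (b s) + low r c"
      unfolding low_def sum.distrib[symmetric]
      by (intro sum.cong) (auto simp: d_def distrib_right)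
    moreover have "(\<Sum>k\<in>{Suc r..<m}. d k * p ^ k) = (\<Sum>k\<in>{Suc r..<m}. b s k * p ^ k)"
      by (intro sum.cong) (auto simp: d_def)
    moreover have "p ^ r + d r * p ^ r = b s r * p ^ r" using s(2) by (cases "b s r") (auto simp: d_def)
    ultimately show ?thesis unfolding low_at[OF assms(2), of d] low_at[OF assms(2), of "b s"] using assms(4) by simp
  qed
  have chain: "chain e N b'"
    unfolding chain_def
  proof (intro conjI allI impI)
    fix t assume "t < e" thus "low m (b' t) = p ^ m - 1"
      using bin low_d by (cases "t = s") (auto simp: b'_def)
  next
    fix k assume k: "k < m"
    hence "cnt b e k \<le> N k" using assms(1) by (simp add: chain_def)
    thus "cnt b' e k \<le> N k"
      using cnt_low[OF s(1), of k] cnt_r[OF s(1)] cnt_high[OF s(1), of k] assms(5)[of k]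
      by (cases k r rule: linorder_cases) auto
  qed
  have ex: "weight (cnt b t) + window r (cnt b t) c = weight (cnt b' t) + V" if "s < t" "t \<le> e" for t
  proof -
    have "weight (cnt b t) + window r (cnt b t) c = weight (cnt b' t) + val r (cnt b' t r)"
      using assms(2) cnt_r[OF that(1)] cnt_low[OF that(1)] cnt_high[OF that(1)]
      by (intro weight_exchange) auto
    thus ?thesis using cnt_r[OF that(1)] cnt_e[OF that] by (simp add: V_def)
  qed
  have win_e: "window r (cnt b e) c < V"
    unfolding V_def val_def using assms(2,6) by (intro window_lt) auto
  \<comment> \<open>Earlier prefixes have consumed fewer small items, so there the replacements
    start at lower indices and are no dearer.\<close>
  have win: "window r (cnt b t) c < V" if "t \<le> e" for t
    using window_mono[of r "cnt b t" "cnt b e" c] assms(2) cnt_mono[OF that] win_e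
    by (meson le_less_trans less_imp_le)
  have "(\<Sum>t\<in>{Suc s..<e}. weight (cnt b' t)) \<le> (\<Sum>t\<in>{Suc s..<e}. weight (cnt b t))"
  proof (rule sum_mono)
    fix t assume "t \<in> {Suc s..<e}"
    thus "weight (cnt b' t) \<le> weight (cnt b t)" using ex[of t] win[of t] by simp
  qed
  moreover have "{Suc s..e} = insert e {Suc s..<e}" using s(1) by auto
  moreover have "(\<Sum>t\<in>{1..s}. weight (cnt b' t)) = (\<Sum>t\<in>{1..s}. weight (cnt b t))"
    by (intro sum.cong refl arg_cong[of _ _ weight] ext cnt_before) auto
  ultimately have cost: "cost e b' + V \<le> cost e b + window r (cnt b e) c"
    unfolding cost_split[OF s(1)] using ex[of e] s(1) by simp
  show thesis
    by (rule that[OF chain]) (use cost win_e V_def in auto)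
qed

text \<open>The most valuable item in which two packings differ has class \<open>r0\<close>. Inserting an item of a larger
  class \<open>r\<close> frees smaller items; these either contain something at least as valuable, or can replace the
  item of class \<open>r0\<close>, or include one of an intermediate class, which is inserted next.\<close>

lemma insert_item_cascade:
  assumes "chain e N b" "r0 < r" "r < m" "0 < cnt b e r0" "cnt b e r < N r"
    and "pos r (cnt b e r) < pos r0 (cnt b e r0 - 1)"
    and "\<And>l. r0 < l \<Longrightarrow> l \<le> r \<Longrightarrow> \<exists>s<e. p ^ l \<le> low l (b s)"
  shows "\<exists>b'. chain e N b' \<and>
    (p ^ m - 1) * (cost e b' + val r0 (cnt b e r0 - 1))
      \<le> (p ^ m - 1) * (cost e b + val r (cnt b e r)) + (r - r0) * p ^ (pos r0 (cnt b e r0 - 1) - 1)"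
  using assms
proof (induction r arbitrary: b rule: less_induct)
  case (less r b)
  define P where "P = pos r0 (cnt b e r0 - 1)"
  define M where "M = p ^ (P - 1)"
  define q where "q = p ^ m - 1"
  obtain s0 where s0: "s0 < e" "p ^ r \<le> low r (b s0)" using less.prems(2,7) by blast
  obtain b1 c where b1: "chain e N b1" and c: "low r c = p ^ r"
    and cnt_r: "cnt b1 e r = Suc (cnt b e r)"
    and cnt_low: "\<And>k. k < r \<Longrightarrow> cnt b e k = cnt b1 e k + c k"
    and cost: "(p ^ m - 1) * (cost e b1 + window r (cnt b1 e) c)
      \<le> (p ^ m - 1) * cost e b + p ^ m * val r (cnt b e r)"
    and low: "\<And>l s. l \<le> r \<Longrightarrow> s < e \<Longrightarrow> (\<forall>k<l. c k = 0) \<Longrightarrow> low l (b1 s) = low l (b s)"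
    using insert_item[OF less.prems(1,3) s0 less.prems(5)] by metis
  have le_N: "cnt b e k \<le> N k" if "k < m" for k using less.prems(1) that by (simp add: chain_def)
  have val_M: "val r (cnt b e r) \<le> M"
    using less.prems(6) p_pos unfolding val_def M_def P_def by (intro power_increasing) auto
  \<comment> \<open>Scaled by \<open>q\<close>, the bound of \<open>insert_item\<close> charges one
    \<open>val r\<close> beyond the price of the item, and this is at most \<open>M\<close>. As the
    inserted class falls strictly but stays above \<open>r0\<close>, at most \<open>r - r0\<close>
    such charges arise.\<close>
  have "p ^ m * x = q * x + x" for x unfolding q_def using p_pos by (simp add: diff_mult_distrib)
  hence cost': "q * (cost e b1 + window r (cnt b1 e) c) \<le> q * (cost e b + val r (cnt b e r)) + M"
    using cost val_M unfolding q_def[symmetric] by (simp add: distrib_left)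
  have M_le: "M \<le> (r - r0) * M" using less.prems(2) by (cases "r - r0") auto
  have finish: ?case if "chain e N b'" "cost e b' + p ^ P \<le> cost e b1 + window r (cnt b1 e) c" for b'
  proof -
    have "q * (cost e b' + p ^ P) \<le> q * (cost e b1 + window r (cnt b1 e) c)"
      using that(2) by (rule mult_le_mono2)
    hence "q * (cost e b' + p ^ P) \<le> q * (cost e b + val r (cnt b e r)) + (r - r0) * M"
      using cost' M_le by linarith
    thus ?thesis using that(1) unfolding q_def M_def P_def val_def by blast
  qed
  \<comment> \<open>The cases distinguish whether some freed item is worth at least
    \<open>p ^ P\<close>; the dearest item freed in class \<open>k\<close> has index
    \<open>cnt b e k - 1\<close>.\<close>
  show ?case
  proof (cases "\<exists>k<r. 0 < c k \<and> P \<le> pos k (cnt b e k - 1)")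
    case True
    then obtain k where k: "k < r" "0 < c k" "P \<le> pos k (cnt b e k - 1)" by blast
    have "p ^ P \<le> val k (cnt b e k - 1)"
      unfolding val_def using k(3) p_pos by (intro power_increasing) auto
    also have "\<dots> \<le> window r (cnt b1 e) c"
      using k cnt_low[OF k(1)] by (intro val_le_window) auto
    finally show ?thesis using finish[OF b1] by simp
  next
    case False
    have items: "pos k i < P" if "k < r" "i < cnt b1 e k + c k" "0 < c k" for k i
    proof -
      have "pos k i \<le> pos k (cnt b e k - 1)"
        using cnt_low[OF that(1)] that less.prems(3) by (intro pos_mono) auto
      thus ?thesis using False that by fastforce
    qed
    \<comment> \<open>If class \<open>r0\<close> lost items, its top one at position
      \<open>P\<close> would be among them, contrary to \<open>items\<close>.\<close>
    have r0: "c r0 = 0"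
    proof (rule ccontr)
      assume "c r0 \<noteq> 0"
      thus False using items[of r0 "cnt b e r0 - 1"] cnt_low[of r0] less.prems(2) by (simp add: P_def)
    qed
    have cnt_r0: "cnt b1 e r0 = cnt b e r0" using cnt_low[OF less.prems(2)] r0 by simp
    have "\<exists>k<r. 0 < c k"
    proof (rule ccontr)
      assume "\<not> (\<exists>k<r. 0 < c k)"
      hence "low r c = 0" by (simp add: low_def)
      thus False using c p_pos by simp
    qed
    \<comment> \<open>The smallest freed class decides: above \<open>r0\<close>, one of its items is
      inserted next; below \<open>r0\<close>, freed items replace the item of class
      \<open>r0\<close>. Minimality leaves \<open>low l'\<close> of every bin unchanged for
      \<open>l' \<le> l\<close>, which the induction hypothesis requires.\<close>
    define l where "l = (LEAST k. k < r \<and> 0 < c k)"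
    have l: "l < r" "0 < c l"
      using LeastI_ex[OF \<open>\<exists>k<r. 0 < c k\<close>] unfolding l_def by auto
    have l_least: "c k = 0" if "k < l" for k
      using not_less_Least[of k "\<lambda>k. k < r \<and> 0 < c k"] that l unfolding l_def by auto
    show ?thesis
    proof (cases "r0 < l")
      case True
      have "\<exists>b'. chain e N b' \<and>
        (p ^ m - 1) * (cost e b' + val r0 (cnt b1 e r0 - 1))
          \<le> (p ^ m - 1) * (cost e b1 + val l (cnt b1 e l)) + (l - r0) * p ^ (pos r0 (cnt b1 e r0 - 1) - 1)"
      proof (rule less.IH[OF l(1) b1 True])
        show "l < m" using l less.prems(3) by simp
        thus "cnt b1 e l < N l" using cnt_low[OF l(1)] le_N[of l] l(2) by simp
        show "0 < cnt b1 e r0" using cnt_r0 less.prems(4) by simp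
        show "pos l (cnt b1 e l) < pos r0 (cnt b1 e r0 - 1)"
          using items[OF l(1) _ l(2), of "cnt b1 e l"] l(2) cnt_r0 by (simp add: P_def)
        show "\<exists>s<e. p ^ l' \<le> low l' (b1 s)" if l': "r0 < l'" "l' \<le> l" for l'
        proof -
          obtain s where "s < e" "p ^ l' \<le> low l' (b s)" using less.prems(7)[of l'] l' l by auto
          moreover have "low l' (b1 s) = low l' (b s)"
            using l' l l_least \<open>s < e\<close> by (intro low) auto
          ultimately show ?thesis by auto
        qed
      qed
      then obtain b' where b': "chain e N b'"
        "q * (cost e b' + p ^ P) \<le> q * (cost e b1 + val l (cnt b1 e l)) + (l - r0) * M"
        unfolding cnt_r0 q_def M_def P_def val_def by blast
      have "val l (cnt b1 e l) \<le> window r (cnt b1 e) c" using l by (intro val_le_window) auto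
      hence "q * (cost e b1 + val l (cnt b1 e l)) \<le> q * (cost e b1 + window r (cnt b1 e) c)" by simp
      moreover have "(l - r0) * M + M \<le> (r - r0) * M"
      proof -
        have "Suc (l - r0) * M \<le> (r - r0) * M" using l True by (intro mult_le_mono1) auto
        thus ?thesis by simp
      qed
      ultimately have "q * (cost e b' + p ^ P) \<le> q * (cost e b + val r (cnt b e r)) + (r - r0) * M"
        using b'(2) cost' by linarith
      thus ?thesis using b'(1) unfolding q_def M_def P_def val_def by blast
    next
      case False
      \<comment> \<open>The whole freed size \<open>p ^ r\<close> and its part in classes from
        \<open>r0\<close> on are multiples of \<open>p ^ r0\<close>. So is the remaining nonzero
        part, which therefore contains a selection of size exactly \<open>p ^ r0\<close>.\<close>
      have "p ^ r0 dvd low r0 c"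
      proof -
        have "p ^ r0 dvd low r c" unfolding c using less.prems(2) by (intro le_imp_power_dvd) simp
        moreover have "low r c = (low r c - low r0 c) + low r0 c"
          using low_split(2)[of r0 r c] less.prems(2) by simp
        moreover have "p ^ r0 dvd low r c - low r0 c" using less.prems(2) by (intro low_split) simp
        ultimately show ?thesis by (metis dvd_add_right_iff)
      qed
      moreover have "0 < low r0 c"
      proof -
        have "l < r0" using False l r0 by (cases "l = r0") auto
        hence "c l * p ^ l \<le> low r0 c" unfolding low_def
          by (intro member_le_sum[of l "{..<r0}" "\<lambda>k. c k * p ^ k"]) auto
        thus ?thesis using l(2) p_pos by (metis less_le_trans mult_pos_pos zero_less_power)
      qed
      ultimately have "p ^ r0 \<le> low r0 c" by (rule dvd_imp_le)
      then obtain c' where c': "\<And>k. c' k \<le> c k" "low r0 c' = p ^ r0"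
        using subset_sum_powers[OF p_pos dvd_refl, of r0 c] by (auto simp: low_def)
      obtain b2 where b2: "chain e N b2"
        "cost e b2 + val r0 (cnt b1 e r0 - 1) \<le> cost e b1 + window r0 (cnt b1 e) c'"
      proof (rule replace_item[OF b1 _ _ c'(2)])
        show "r0 < m" using less.prems(2,3) by simp
        show "0 < cnt b1 e r0" using cnt_r0 less.prems(4) by simp
        show "cnt b1 e k + c' k \<le> N k" if "k < r0" for k
          using cnt_low[of k] c'(1)[of k] le_N[of k] that less.prems(2,3) by simp
        show "pos k i < pos r0 (cnt b1 e r0 - 1)"
          if "k < r0" "cnt b1 e k \<le> i" "i < cnt b1 e k + c' k" for k i
          using items[of k i] that c'(1)[of k] less.prems(2) cnt_r0 by (simp add: P_def)
      qed blast
      have "window r0 (cnt b1 e) c' \<le> window r0 (cnt b1 e) c"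
        using c'(1) by (intro window_mono_size)
      also have "\<dots> \<le> window r (cnt b1 e) c"
        unfolding window_def using less.prems(2) by (intro sum_mono2) auto
      finally show ?thesis using finish[OF b2(1)] b2(2) cnt_r0 unfolding val_def P_def by simp
    qed
  qed
qed

text \<open>\<open>A\<close> and \<open>A'\<close> count the items in which \<open>b2\<close>
  exceeds \<open>b\<close> and vice versa. If the excess of \<open>b2\<close> below class
  \<open>r0\<close> has size at least \<open>p ^ r0\<close>, it can replace the item of class
  \<open>r0\<close>. Otherwise equality of the total sizes forces an excess of \<open>b2\<close>
  above \<open>r0\<close>, and the lowest such class starts the cascade.\<close>

lemma improve_chain:
  assumes "chain e N b" "chain e N b2" "r0 < m" "cnt b2 e r0 < cnt b e r0"
    and top: "\<And>r. r < m \<Longrightarrow> cnt b e r < cnt b2 e r \<Longrightarrow> pos r (cnt b2 e r - 1) < pos r0 (cnt b e r0 - 1)"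
  shows "\<exists>b'. chain e N b' \<and> cost e b' < cost e b"
proof -
  define n where "n = cnt b e"
  define n2 where "n2 = cnt b2 e"
  have N: "n2 k \<le> N k" if "k < m" for k using assms(2) that by (simp add: chain_def n2_def)
  have missing: "pos k i < pos r0 (n r0 - 1)" if "k < m" "i < n2 k" "n k \<le> i" for k i
  proof -
    have "pos k i \<le> pos k (n2 k - 1)" using that by (intro pos_mono) auto
    also have "\<dots> < pos r0 (n r0 - 1)" unfolding n_def n2_def using that by (intro top) (auto simp: n_def n2_def)
    finally show ?thesis .
  qed
  define A where "A k = n2 k - n k" for k
  define A' where "A' k = n k - n2 k" for k
  have A: "low l n + low l A = low l n2 + low l A'" for l
    unfolding low_def sum.distrib[symmetric] distrib_right[symmetric]
    by (intro sum.cong) (auto simp: A_def A'_def)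
  show ?thesis
  proof (cases "p ^ r0 \<le> low r0 A")
    case True
    then obtain c where c: "\<And>k. c k \<le> A k" "low r0 c = p ^ r0"
      using subset_sum_powers[OF p_pos dvd_refl, of r0 A] by (auto simp: low_def)
    obtain b' where "chain e N b'" "cost e b' < cost e b"
    proof (rule replace_item[OF assms(1,3) _ c(2)])
      show "0 < cnt b e r0" using assms(4) by simp
      show "cnt b e k + c k \<le> N k" if "k < r0" for k
      proof -
        have "k < m" using that assms(3) by simp
        hence "n k \<le> N k" "n2 k \<le> N k" using assms(1) N by (auto simp: chain_def n_def)
        thus ?thesis using c(1)[of k] by (simp add: A_def n_def)
      qed
      show "pos k i < pos r0 (cnt b e r0 - 1)"
        if "k < r0" "cnt b e k \<le> i" "i < cnt b e k + c k" for k i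
        using missing[of k i] that c(1)[of k] assms(3) by (simp add: A_def n_def)
    qed blast
    thus ?thesis by blast
  next
    case False
    have A'_ge: "p ^ r0 \<le> low l A'" if "r0 < l" for l
    proof -
      have "1 * p ^ r0 \<le> A' r0 * p ^ r0"
        using assms(4) by (intro mult_le_mono1) (simp add: A'_def n_def n2_def)
      also have "\<dots> \<le> low l A'" unfolding low_def
        using that by (intro member_le_sum[of r0 "{..<l}" "\<lambda>k. A' k * p ^ k"]) auto
      finally show ?thesis by simp
    qed
    have A_r0: "A r0 = 0" using assms(4) by (simp add: A_def n_def n2_def)
    have A_low: "low l A = low r0 A" if "r0 < l" "\<And>k. r0 < k \<Longrightarrow> k < l \<Longrightarrow> A k = 0" for l
      unfolding low_def using that A_r0
      by (intro sum.mono_neutral_right) (auto simp: not_less le_less)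
    have same: "low m n = low m n2"
      unfolding n_def n2_def low_cnt using assms(1,2) by (auto simp: chain_def intro!: sum.cong)
    have "\<exists>r. r0 < r \<and> r < m \<and> 0 < A r"
    proof (rule ccontr)
      assume "\<not> ?thesis"
      hence "low m A = low r0 A" using assms(3) by (intro A_low) auto
      thus False using A[of m] same A'_ge[OF assms(3)] False by simp
    qed
    define r where "r = (LEAST r. r0 < r \<and> r < m \<and> 0 < A r)"
    have r: "r0 < r" "r < m" "0 < A r"
      using LeastI_ex[OF \<open>\<exists>r. r0 < r \<and> r < m \<and> 0 < A r\<close>] unfolding r_def by auto
    have least: "A k = 0" if "r0 < k" "k < r" for k
      using not_less_Least[of k "\<lambda>r. r0 < r \<and> r < m \<and> 0 < A r"] that r unfolding r_def by auto
    define P where "P = pos r0 (n r0 - 1)"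
    define M where "M = p ^ (P - 1)"
    define q where "q = p ^ m - 1"
    have pos_r: "pos r (n r) < P" unfolding P_def using r(2,3) by (intro missing) (auto simp: A_def)
    obtain b' where b': "chain e N b'"
      "q * (cost e b' + p ^ P) \<le> q * (cost e b + val r (n r)) + (r - r0) * M"
    proof -
      have "\<exists>b'. chain e N b' \<and>
        (p ^ m - 1) * (cost e b' + val r0 (cnt b e r0 - 1))
          \<le> (p ^ m - 1) * (cost e b + val r (cnt b e r)) + (r - r0) * p ^ (pos r0 (cnt b e r0 - 1) - 1)"
      proof (rule insert_item_cascade[OF assms(1) r(1,2)])
        show "0 < cnt b e r0" using assms(4) by simp
        show "cnt b e r < N r" using r(3) N[OF r(2)] by (simp add: A_def n_def)
        show "pos r (cnt b e r) < pos r0 (cnt b e r0 - 1)" using pos_r by (simp add: P_def n_def)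
        \<comment> \<open>Otherwise the classes below \<open>l\<close> would have in
          \<open>b\<close> at most the size \<open>e * (p ^ l - 1)\<close> that every packing needs
          there, although below \<open>l\<close> the excess of \<open>b\<close> is larger than that
          of \<open>b2\<close>.\<close>
        show "\<exists>s<e. p ^ l \<le> low l (b s)" if l: "r0 < l" "l \<le> r" for l
        proof (rule ccontr)
          assume neg: "\<not> (\<exists>s<e. p ^ l \<le> low l (b s))"
          have lm: "l \<le> m" using l r by simp
          have "low l n \<le> (\<Sum>s<e. p ^ l - 1)"
            unfolding n_def low_cnt using neg by (intro sum_mono) (force simp: not_le)
          also have "\<dots> \<le> low l n2"
            unfolding n2_def low_cnt using assms(2) lm
            by (intro sum_mono low_bin_ge) (auto simp: chain_def)
          finally have "low l A' \<le> low l A" using A[of l] by simp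
          moreover have "low l A = low r0 A" using l least by (intro A_low) auto
          ultimately show False using A'_ge[OF l(1)] False by simp
        qed
      qed
      thus thesis using that unfolding q_def M_def P_def n_def val_def by blast
    qed
    \<comment> \<open>Final balance, scaled by \<open>q\<close>: the new item costs at most
      \<open>q * M\<close>, the overhead is below \<open>m * M \<le> q * M\<close>, and the saving
      \<open>q * p ^ P\<close> is at least \<open>2 * q * M\<close>.\<close>
    have "m < p ^ m" using p_ge_2 by (metis less_exp less_le_trans power_mono zero_le)
    hence q: "m \<le> q" by (simp add: q_def)
    have PM: "p ^ P = p * M" using pos_r by (cases P) (auto simp: M_def)
    have "val r (n r) \<le> M" unfolding val_def M_def using pos_r p_pos by (intro power_increasing) auto
    hence "q * val r (n r) \<le> q * M" by simp
    moreover have "(r - r0) * M < q * M"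
      using r q p_pos by (intro mult_strict_right_mono) (auto simp: M_def)
    moreover have "2 * (q * M) \<le> q * p ^ P" unfolding PM using p_ge_2 by simp
    ultimately have "q * cost e b' < q * cost e b" using b'(2) unfolding distrib_left by linarith
    thus ?thesis using b'(1) by auto
  qed
qed

section \<open>Uniqueness of optimal packings\<close>

definition optimal :: "nat \<Rightarrow> (nat \<Rightarrow> nat) \<Rightarrow> (nat \<Rightarrow> nat \<Rightarrow> nat) \<Rightarrow> bool" where
  "optimal e N b \<longleftrightarrow> chain e N b \<and> (\<forall>b'. chain e N b' \<longrightarrow> cost e b \<le> cost e b')"

text \<open>For a class with different counts, \<open>h\<close> is the top differing position. Its
  maximum is attained in one class only, since positions in distinct classes differ modulo
  \<open>m\<close>; the packing that uses the item there can be improved.\<close>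

lemma optimal_cnt_eq:
  assumes "optimal e N b" "optimal e N b2" "r < m"
  shows "cnt b e r = cnt b2 e r"
proof (rule ccontr)
  define D where "D = {r. r < m \<and> cnt b e r \<noteq> cnt b2 e r}"
  define h where "h r = pos r (max (cnt b e r) (cnt b2 e r) - 1)" for r
  assume "cnt b e r \<noteq> cnt b2 e r"
  hence D: "finite D" "D \<noteq> {}" using assms(3) by (auto simp: D_def)
  obtain r0 where r0: "r0 \<in> D" "\<And>r. r \<in> D \<Longrightarrow> h r \<le> h r0"
    using Max_in[of "h ` D"] Max_ge[of "h ` D"] D by (metis (no_types, lifting) finite_imageI image_iff image_is_empty)
  have h_less: "h r < h r0" if "r \<in> D" "r \<noteq> r0" for r
    using r0(2)[OF that(1)] pos_mod[of r] pos_mod[of r0] r0(1) that unfolding h_def D_def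
    by (metis (no_types, lifting) le_neq_implies_less mem_Collect_eq)
  have gen: False if "optimal e N x" "optimal e N y" "cnt y e r0 < cnt x e r0"
    and h: "\<And>r. h r = pos r (max (cnt x e r) (cnt y e r) - 1)"
    and mem: "\<And>r. r < m \<Longrightarrow> cnt x e r \<noteq> cnt y e r \<Longrightarrow> r \<in> D" for x y
  proof -
    have "\<exists>b'. chain e N b' \<and> cost e b' < cost e x"
    proof (rule improve_chain)
      show "chain e N x" "chain e N y" using that(1,2) by (simp_all add: optimal_def)
      show "r0 < m" using r0(1) by (simp add: D_def)
      show "pos r (cnt y e r - 1) < pos r0 (cnt x e r0 - 1)"
        if r: "r < m" "cnt x e r < cnt y e r" for r
        using h_less[of r] mem[of r] r \<open>cnt y e r0 < cnt x e r0\<close>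
        by (cases "r = r0") (auto simp: h max_def)
    qed (fact that(3))
    thus False using that(1) by (auto simp: optimal_def not_less[symmetric])
  qed
  show False
  proof (cases "cnt b2 e r0 < cnt b e r0")
    case True
    show ?thesis by (rule gen[OF assms(1,2) True]) (auto simp: h_def D_def)
  next
    case False
    hence "cnt b e r0 < cnt b2 e r0" using r0(1) by (simp add: D_def)
    from gen[OF assms(2,1) this] show ?thesis by (auto simp: h_def D_def max.commute)
  qed
qed

lemma weight_cong: "(\<And>r. r < m \<Longrightarrow> n r = n' r) \<Longrightarrow> weight n = weight n'"
  unfolding weight_def by (intro sum.cong) auto

lemma low_cong: "(\<And>k. k < r \<Longrightarrow> c k = c' k) \<Longrightarrow> low r c = low r c'"
  unfolding low_def by (intro sum.cong) auto

lemma cnt_Suc: "cnt b (Suc t) r = cnt b t r + b t r"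
  by (simp add: cnt_def)

text \<open>A cheaper packing of \<open>e\<close> bins within the same items could be completed by
  the leftover items: they have the size of one bin, and the last prefix keeps its weight. Fixing
  \<open>N'\<close> only below \<open>m\<close> lets two packings with equal counts share one
  \<open>N'\<close>.\<close>

lemma optimal_prefix:
  assumes "optimal (Suc e) N b" "\<And>r. r < m \<Longrightarrow> N' r = cnt b (Suc e) r"
  shows "optimal e N' b"
proof -
  have b: "chain (Suc e) N b" using assms(1) by (simp add: optimal_def)
  have le: "cnt b e r \<le> N' r" if "r < m" for r using assms(2)[OF that] by (simp add: cnt_Suc)
  show ?thesis
    unfolding optimal_def
  proof (intro conjI allI impI)
    show "chain e N' b" using b le by (auto simp: chain_def)
    fix b0 assume b0: "chain e N' b0"
    define b' where "b' = b0(e := \<lambda>r. N' r - cnt b0 e r)"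
    have cnt': "cnt b' t r = cnt b0 t r" if "t \<le> e" for t r
      unfolding b'_def cnt_def using that by (intro sum.cong) auto
    have cnt_e: "cnt b' (Suc e) r = cnt b (Suc e) r" if "r < m" for r
    proof -
      have "cnt b0 e r \<le> N' r" using b0 that by (simp add: chain_def)
      thus ?thesis using cnt'[of e r] assms(2)[OF that] by (simp add: cnt_Suc b'_def)
    qed
    have low_sum: "low m (cnt x (Suc e)) = low m (cnt x e) + low m (x e)" for x
      unfolding low_cnt by simp
    have "low m (cnt b' e) = low m (cnt b e)"
      unfolding low_cnt
    proof (intro sum.cong refl)
      fix s assume "s \<in> {..<e}"
      thus "low m (b' s) = low m (b s)" using b b0 by (simp add: chain_def b'_def)
    qed
    moreover have "low m (cnt b' (Suc e)) = low m (cnt b (Suc e))"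
      using cnt_e by (intro low_cong)
    ultimately have "low m (b' e) = low m (b e)" using low_sum[of b'] low_sum[of b] by simp
    hence "chain (Suc e) N b'"
      using b b0 cnt_e by (auto simp: chain_def less_Suc_eq b'_def)
    hence "cost (Suc e) b \<le> cost (Suc e) b'" using assms(1) by (simp add: optimal_def)
    moreover have "weight (cnt b' (Suc e)) = weight (cnt b (Suc e))" by (intro weight_cong cnt_e)
    moreover have "cost e b' = cost e b0"
      unfolding cost_def using cnt' by (intro sum.cong weight_cong) auto
    ultimately show "cost e b \<le> cost e b0" by (simp add: cost_def)
  qed
qed

lemma optimal_unique:
  assumes "optimal e N b" "optimal e N b2" "t \<le> e" "r < m"
  shows "cnt b t r = cnt b2 t r"
  using assms(1-3)
proof (induction e arbitrary: N)
  case (Suc e)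
  have eq: "cnt b (Suc e) r = cnt b2 (Suc e) r" if "r < m" for r
    using optimal_cnt_eq[OF Suc.prems(1,2) that] .
  show ?case
  proof (cases "t = Suc e")
    case True
    thus ?thesis using eq[OF assms(4)] by simp
  next
    case False
    have "optimal e (cnt b (Suc e)) b" "optimal e (cnt b (Suc e)) b2"
      using Suc.prems(1,2) eq by (auto intro: optimal_prefix)
    from Suc.IH[OF this] show ?thesis using False Suc.prems(3) by simp
  qed
qed (simp add: cnt_def)

lemma optimal_exists:
  assumes "chain e N b"
  obtains b' where "optimal e N b'"
  using ex_has_least_nat[of "chain e N" b "cost e"] assms unfolding optimal_def by blast

section \<open>Existence of packings\<close>

text \<open>With \<open>n\<close> the base-\<open>p\<close> digits of \<open>j\<close>, collected by position modulo \<open>m\<close>, this is the base-\<open>p\<^sup>m\<close>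
  digit sum of \<open>p\<^sup>i j\<close>.\<close>

definition rot :: "nat \<Rightarrow> (nat \<Rightarrow> nat) \<Rightarrow> nat" where
  "rot i n = (\<Sum>r<m. n r * p ^ ((r + i) mod m))"

lemma rot_0: "rot 0 n = low m n"
  unfolding rot_def low_def by (intro sum.cong) auto

lemma rot_m: "rot m n = rot 0 n"
  unfolding rot_def by (intro sum.cong) auto

text \<open>Rotation multiplies each size by \<open>p\<close>, except that class
  \<open>m - 1 - i\<close> wraps from \<open>p ^ (m - 1)\<close> to \<open>1\<close> instead of
  \<open>p ^ m\<close>; the second summand compensates for this.\<close>

lemma rot_Suc:
  assumes "i < m"
  shows "rot (Suc i) n + (p ^ m - 1) * n (m - 1 - i) = p * rot i n"
proof -
  have mem: "m - 1 - i \<in> {..<m}" using assms by auto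
  have q: "1 + (p ^ m - 1) = p ^ m" using p_pos by simp
  have "(\<Sum>r\<in>{..<m} - {m - 1 - i}. n r * p ^ ((r + Suc i) mod m))
      = (\<Sum>r\<in>{..<m} - {m - 1 - i}. p * (n r * p ^ ((r + i) mod m)))"
  proof (rule sum.cong)
    fix r assume r: "r \<in> {..<m} - {m - 1 - i}"
    have "Suc (r + i) mod m = Suc ((r + i) mod m)"
    proof (cases "Suc ((r + i) mod m) = m")
      case True
      have "r + i < m \<or> (m \<le> r + i \<and> r + i < 2 * m)" using r assms by auto
      hence False
      proof
        assume "r + i < m" thus False using True r by auto
      next
        assume a: "m \<le> r + i \<and> r + i < 2 * m"
        hence "(r + i) mod m = r + i - m" by (subst le_mod_geq) auto
        thus False using True r assms a by auto
      qed
      thus ?thesis ..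
    next
      case False
      thus ?thesis by (simp add: mod_Suc)
    qed
    thus "n r * p ^ ((r + Suc i) mod m) = p * (n r * p ^ ((r + i) mod m))" by simp
  qed simp
  moreover have "(m - 1 - i + Suc i) mod m = 0" "(m - 1 - i + i) mod m = m - 1" using assms by auto
  moreover have "n (m - 1 - i) + (p ^ m - 1) * n (m - 1 - i) = p * (n (m - 1 - i) * p ^ (m - 1))"
  proof -
    have "n (m - 1 - i) + (p ^ m - 1) * n (m - 1 - i) = (1 + (p ^ m - 1)) * n (m - 1 - i)"
      by (simp only: distrib_right mult_1)
    also have "\<dots> = p * (n (m - 1 - i) * p ^ (m - 1))"
      unfolding q using m_pos by (cases m) auto
    finally show ?thesis .
  qed
  ultimately show ?thesis
    unfolding rot_def sum.remove[OF finite_lessThan mem] distrib_left sum_distrib_left[symmetric]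
    by simp
qed

lemma rot_diff:
  assumes "\<And>r. r < m \<Longrightarrow> c r \<le> n r"
  shows "rot i n = rot i (\<lambda>r. n r - c r) + rot i c"
  unfolding rot_def sum.distrib[symmetric] distrib_right[symmetric]
  using assms by (intro sum.cong) auto

text \<open>The bin is described by its own values \<open>rot i c = (p\<^sup>m - 1) z\<^sub>i\<close>, chosen greedily.\<close>

lemma exists_bin:
  assumes ge: "\<And>i. i < m \<Longrightarrow> Suc e * (p ^ m - 1) \<le> rot i n"
    and lt: "rot 0 n < Suc (Suc e) * (p ^ m - 1)"
  obtains c where "\<And>r. r < m \<Longrightarrow> c r \<le> n r" "low m c = p ^ m - 1"
    "\<And>i. i < m \<Longrightarrow> e * (p ^ m - 1) + rot i c \<le> rot i n"
proof -
  define q where "q = p ^ m - 1"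
  have "p \<le> p ^ m" using p_pos m_pos by (intro self_le_power) auto
  hence q: "0 < q" using p_ge_2 by (simp add: q_def)
  \<comment> \<open>The largest multiple of \<open>q\<close> that the new bin may take at rotation
    \<open>i\<close> while leaving \<open>e * q\<close> for the others.\<close>
  define Y where "Y i = (rot i n - e * q) div q" for i
  have ge': "q + e * q \<le> rot i n" if "i \<le> m" for i
  proof (cases "i = m")
    case True
    thus ?thesis using ge[of 0] rot_m[of n] m_pos by (simp add: q_def)
  next
    case False
    thus ?thesis using ge[of i] that by (simp add: q_def)
  qed
  have Y_pos: "1 \<le> Y i" if "i \<le> m" for i
  proof -
    have "q \<le> rot i n - e * q" using ge'[OF that] by simp
    thus ?thesis using q unfolding Y_def by (metis div_le_mono div_self less_not_refl)
  qed
  have "rot 0 n - e * q < 2 * q" using lt ge'[of 0] unfolding q_def[symmetric] mult_Suc by simp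
  hence "Y 0 < 2" unfolding Y_def using less_mult_imp_div_less by blast
  hence Y0: "Y 0 = 1" "Y m = 1" using Y_pos[of 0] rot_m[of n] by (auto simp: Y_def)
  \<comment> \<open>By \<open>rot_Suc\<close> the values \<open>z\<close> determine the bin: class
    \<open>m - 1 - i\<close> needs \<open>p * z i - z (Suc i)\<close> items. Taking
    \<open>z (Suc i)\<close> as large as \<open>Y\<close> and nonnegativity permit keeps that number
    small.\<close>
  define z where "z = rec_nat 1 (\<lambda>i x. min (p * x) (Y (Suc i)))"
  have z: "z 0 = 1" "z (Suc i) = min (p * z i) (Y (Suc i))" for i by (simp_all add: z_def)
  have z_le: "z i \<le> Y i" for i using Y0 by (cases i) (auto simp: z)
  have z_pos: "1 \<le> z i" if "i \<le> m" for i
    using that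
  proof (induction i)
    case (Suc i)
    thus ?case using Y_pos[of "Suc i"] p_pos by (auto simp: z)
  qed (simp add: z)
  have z_m: "z m = 1" using z_le[of m] z_pos[of m] Y0 by simp
  define c where "c r = p * z (m - 1 - r) - z (m - r)" for r
  have c_at: "c (m - 1 - i) + z (Suc i) = p * z i" if "i < m" for i
  proof -
    have "m - 1 - (m - 1 - i) = i" "m - (m - 1 - i) = Suc i" using that by auto
    thus ?thesis unfolding c_def by (simp add: z)
  qed
  have c_le: "c (m - 1 - i) \<le> n (m - 1 - i)" if "i < m" for i
  proof (cases "p * z i \<le> Y (Suc i)")
    case True
    thus ?thesis using c_at[OF that] by (simp add: z)
  next
    case False
    \<comment> \<open>Where \<open>z\<close> meets the bound \<open>Y\<close>, dividing
      \<open>rot_Suc\<close> for \<open>n\<close> by \<open>q\<close> yields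
      \<open>p * Y i \<le> Y (Suc i) + n (m - 1 - i)\<close>.\<close>
    hence zS: "z (Suc i) = Y (Suc i)" by (simp add: z)
    have "q * Y i \<le> rot i n - e * q" unfolding Y_def by simp
    hence "q * Y i + e * q \<le> rot i n" using ge'[of i] that by simp
    hence "p * (q * Y i + e * q) \<le> rot (Suc i) n + q * n (m - 1 - i)"
      unfolding rot_Suc[OF that, folded q_def] by (rule mult_le_mono2)
    moreover have "e * q \<le> p * (e * q)" using p_pos by simp
    moreover have "rot (Suc i) n = (rot (Suc i) n - e * q) + e * q" using ge'[of "Suc i"] that by simp
    ultimately have "p * (q * Y i) \<le> (rot (Suc i) n - e * q) + q * n (m - 1 - i)"
      unfolding distrib_left by linarith
    hence "q * (p * Y i) \<le> (rot (Suc i) n - e * q) + q * n (m - 1 - i)" by (simp add: mult.left_commute)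
    hence "(q * (p * Y i)) div q \<le> ((rot (Suc i) n - e * q) + q * n (m - 1 - i)) div q"
      by (rule div_le_mono)
    hence "p * Y i \<le> Y (Suc i) + n (m - 1 - i)" using q by (simp add: Y_def)
    moreover have "p * z i \<le> p * Y i" using z_le by simp
    ultimately show ?thesis using c_at[OF that] zS by linarith
  qed
  \<comment> \<open>The discrepancy \<open>rot i c - q * z i\<close> is multiplied by
    \<open>p\<close> at each rotation; having equal values at \<open>0\<close> and \<open>m\<close>,
    it vanishes.\<close>
  have rot_c_int: "int (rot i c) - int q * int (z i) = int p ^ i * (int (rot 0 c) - int q)" if "i \<le> m" for i
    using that
  proof (induction i)
    case (Suc i)
    have "int (rot (Suc i) c) + int q * int (c (m - 1 - i)) = int p * int (rot i c)"
      using arg_cong[OF rot_Suc[of i c, folded q_def], of int] Suc.prems by simp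
    moreover have "int (c (m - 1 - i)) = int p * int (z i) - int (z (Suc i))"
      using arg_cong[OF c_at[of i], of int] Suc.prems by simp
    ultimately have "int (rot (Suc i) c) - int q * int (z (Suc i))
        = int p * (int (rot i c) - int q * int (z i))"
      by (simp add: right_diff_distrib mult.left_commute)
    thus ?case using Suc by simp
  qed (simp add: z)
  have "(int p ^ m - 1) * (int (rot 0 c) - int q) = 0"
    using rot_c_int[of m] z_m rot_m[of c] by (simp add: algebra_simps)
  moreover have "int p ^ m \<noteq> 1"
  proof -
    have "int (p ^ m) \<noteq> 1" using q unfolding q_def of_nat_eq_1_iff by linarith
    thus ?thesis by simp
  qed
  ultimately have "int (rot 0 c) = int q" by simp
  moreover from this have "int (rot i c) = int (q * z i)" if "i \<le> m" for i
    using rot_c_int[OF that] by simp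
  ultimately have rot_c: "rot 0 c = q" "\<And>i. i \<le> m \<Longrightarrow> rot i c = q * z i"
    by (simp_all only: of_nat_eq_iff)
  show thesis
  proof (rule that[of c])
    show "c r \<le> n r" if "r < m" for r
      using c_le[of "m - 1 - r"] that by simp
    show "low m c = p ^ m - 1" using rot_c(1) by (simp add: rot_0 q_def)
    show "e * (p ^ m - 1) + rot i c \<le> rot i n" if "i < m" for i
    proof -
      have "q * z i \<le> q * Y i" using z_le by simp
      also have "\<dots> \<le> rot i n - e * q" unfolding Y_def by simp
      finally show ?thesis using rot_c(2)[of i] ge'[of i] that by (simp add: q_def)
    qed
  qed
qed

text \<open>Bins are split off one by one: \<open>exists_bin\<close> maintains the lower bounds at
  all rotations, and the exact size of the bin maintains the upper bound at rotation
  \<open>0\<close>.\<close>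

lemma chain_exists:
  assumes "\<And>i. i < m \<Longrightarrow> e * (p ^ m - 1) \<le> rot i N" "rot 0 N < Suc e * (p ^ m - 1)"
  shows "\<exists>b. chain e N b"
  using assms
proof (induction e arbitrary: N)
  case 0
  thus ?case by (simp add: chain_def cnt_def)
next
  case (Suc e)
  from exists_bin[OF Suc.prems] obtain c where c: "\<And>r. r < m \<Longrightarrow> c r \<le> N r" "low m c = p ^ m - 1"
    "\<And>i. i < m \<Longrightarrow> e * (p ^ m - 1) + rot i c \<le> rot i N" by metis
  define N' where "N' r = N r - c r" for r
  have rot: "rot i N = rot i N' + rot i c" for i
    unfolding N'_def using c(1) by (rule rot_diff)
  have "\<exists>b. chain e N' b"
  proof (rule Suc.IH)
    show "e * (p ^ m - 1) \<le> rot i N'" if "i < m" for i using c(3)[OF that] rot[of i] by simp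
    show "rot 0 N' < Suc e * (p ^ m - 1)" using Suc.prems(2) rot[of 0] c(2) by (simp add: rot_0)
  qed
  then obtain b where b: "chain e N' b" ..
  have "chain (Suc e) N (b(e := c))"
    unfolding chain_def
  proof (intro conjI allI impI)
    fix s assume "s < Suc e"
    thus "low m ((b(e := c)) s) = p ^ m - 1" using b c(2) by (auto simp: chain_def less_Suc_eq)
  next
    fix r assume r: "r < m"
    have "cnt (b(e := c)) e r = cnt b e r" unfolding cnt_def by (intro sum.cong) auto
    moreover have "cnt b e r \<le> N r - c r" using b r by (simp add: chain_def N'_def)
    ultimately show "cnt (b(e := c)) (Suc e) r \<le> N r" using c(1)[OF r] by (simp add: cnt_Suc)
  qed
  thus ?case by blast
qed

end

subsection \<open>Digits\<close>

definition digit :: "nat \<Rightarrow> nat \<Rightarrow> nat \<Rightarrow> nat" where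
  "digit p x n = x div p ^ n mod p"

lemma digit_less: "0 < p \<Longrightarrow> digit p x n < p"
  by (simp add: digit_def)

lemma digit_0: "digit p x 0 = x mod p"
  by (simp add: digit_def)

lemma digit_Suc: "digit p x (Suc n) = digit p (x div p) n"
  by (simp add: digit_def div_mult2_eq)

lemma digit_eq_0:
  assumes "x < p ^ L" "L \<le> n"
  shows "digit p x n = 0"
proof -
  have "x = 0" if "p = 0" using assms(1) that by (cases L) auto
  moreover have "p ^ L \<le> p ^ n" if "0 < p" using assms(2) that by (intro power_increasing) auto
  ultimately show ?thesis using assms(1) by (cases "p = 0") (auto simp: digit_def)
qed

lemma sum_digit:
  assumes "x < p ^ L"
  shows "(\<Sum>n<L. digit p x n * p ^ n) = x"
  using digit_expansion_nat[of x p L] assms by (simp add: digit_def)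

lemma digit_sum_eq:
  assumes "\<And>n. n < L \<Longrightarrow> g n < p"
  shows "(\<Sum>n<L. g n * p ^ n) < p ^ L"
    and "digit p (\<Sum>n<L. g n * p ^ n) k = (if k < L then g k else 0)"
proof -
  have "(\<Sum>n<L. g n * p ^ n) < p ^ L \<and> digit p (\<Sum>n<L. g n * p ^ n) k = (if k < L then g k else 0)"
    using assms
  proof (induction L arbitrary: g k)
    case (Suc L)
    have eq: "(\<Sum>n<Suc L. g n * p ^ n) = g 0 + p * (\<Sum>n<L. g (Suc n) * p ^ n)"
      unfolding sum.lessThan_Suc_shift by (simp add: sum_distrib_left mult.left_commute)
    have p: "g 0 < p" using Suc.prems by simp
    define y where "y = (\<Sum>n<L. g (Suc n) * p ^ n)"
    have IH: "y < p ^ L" "digit p y n = (if n < L then g (Suc n) else 0)" for n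
      unfolding y_def using Suc.IH[of "\<lambda>n. g (Suc n)" n] Suc.prems by auto
    have div: "(g 0 + p * y) div p = y" "(g 0 + p * y) mod p = g 0" using p by simp_all
    have "g 0 + p * y < p * (y + 1)" using p by simp
    also have "\<dots> \<le> p * p ^ L" using IH(1) by (intro mult_le_mono2) simp
    finally show ?case unfolding eq y_def[symmetric] using IH(2) div
      by (cases k) (simp_all add: digit_0 digit_Suc)
  qed (simp add: digit_def)
  thus "(\<Sum>n<L. g n * p ^ n) < p ^ L"
    and "digit p (\<Sum>n<L. g n * p ^ n) k = (if k < L then g k else 0)" by simp_all
qed

lemma digit_inject:
  assumes "x < p ^ L" "y < p ^ L" "\<And>n. n < L \<Longrightarrow> digit p x n = digit p y n"
  shows "x = y"
proof -
  have "(\<Sum>n<L. digit p x n * p ^ n) = (\<Sum>n<L. digit p y n * p ^ n)"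
    using assms(3) by (intro sum.cong) auto
  thus ?thesis using sum_digit[OF assms(1)] sum_digit[OF assms(2)] by simp
qed

text \<open>By Lucas' theorem, for prime \<open>p\<close> this is the condition that
  \<open>p\<close> does not divide \<open>j choose k\<close>.\<close>

definition submask :: "nat \<Rightarrow> nat \<Rightarrow> nat \<Rightarrow> bool" where
  "submask p k j \<longleftrightarrow> (\<forall>n. digit p k n \<le> digit p j n)"

lemma less_power_self: "2 \<le> p \<Longrightarrow> x < (p::nat) ^ x"
  by (metis less_exp less_le_trans power_mono zero_le)

text \<open>Digitwise domination makes the subtraction free of borrows.\<close>

lemma submask_diff:
  assumes "2 \<le> p" "submask p k j"
  shows "k \<le> j" "digit p (j - k) n = digit p j n - digit p k n"
proof -
  define L where "L = max j k"
  have "x < p ^ L" if "x \<le> L" for x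
  proof -
    have "x < p ^ x" using assms(1) by (rule less_power_self)
    also have "\<dots> \<le> p ^ L" using that assms(1) by (intro power_increasing) auto
    finally show ?thesis .
  qed
  hence L: "j < p ^ L" "k < p ^ L" by (simp_all add: L_def)
  define g where "g n = digit p j n - digit p k n" for n
  have "(\<Sum>n<L. digit p j n * p ^ n) = (\<Sum>n<L. digit p k n * p ^ n) + (\<Sum>n<L. g n * p ^ n)"
    unfolding sum.distrib[symmetric] distrib_right[symmetric]
    using assms(2) by (intro sum.cong) (auto simp: g_def submask_def)
  hence j: "j = k + (\<Sum>n<L. g n * p ^ n)" by (simp add: sum_digit[OF L(1)] sum_digit[OF L(2)])
  thus "k \<le> j" by simp
  have "g n < p" for n
    using digit_less[of p j n] assms(1) unfolding g_def by linarith
  hence "digit p (\<Sum>n<L. g n * p ^ n) n = (if n < L then g n else 0)" by (intro digit_sum_eq(2))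
  moreover have "(\<Sum>n<L. g n * p ^ n) = j - k" using j by simp
  ultimately have "digit p (j - k) n = (if n < L then g n else 0)" by simp
  thus "digit p (j - k) n = digit p j n - digit p k n"
    using digit_eq_0[OF L(1), of n] by (auto simp: g_def)
qed

section \<open>Units of the digits as items\<close>

definition cum :: "nat \<Rightarrow> (nat \<Rightarrow> nat) \<Rightarrow> nat \<Rightarrow> nat \<Rightarrow> nat" where
  "cum m d r n = (\<Sum>k<n. if k mod m = r then d k else 0)"

lemma cum_0: "cum m d r 0 = 0"
  by (simp add: cum_def)

lemma cum_Suc: "cum m d r (Suc n) = cum m d r n + (if n mod m = r then d n else 0)"
  by (simp add: cum_def)

lemma cum_mono: "n \<le> n' \<Longrightarrow> cum m d r n \<le> cum m d r n'"
  unfolding cum_def by (intro sum_mono2) auto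

lemma sum_cum:
  assumes "0 < m"
  shows "(\<Sum>r<m. cum m d r L * f r) = (\<Sum>n<L. d n * f (n mod m))"
proof (induction L)
  case (Suc L)
  have "(\<Sum>r<m. cum m d r (Suc L) * f r)
      = (\<Sum>r<m. cum m d r L * f r) + (\<Sum>r<m. if r = L mod m then d L * f r else 0)"
    unfolding cum_Suc sum.distrib[symmetric] by (intro sum.cong) (auto simp: distrib_right)
  also have "(\<Sum>r<m. if r = L mod m then d L * f r else 0) = d L * f (L mod m)"
    using assms by (simp add: sum.delta)
  finally show ?case using Suc by simp
qed (simp add: cum_0)

text \<open>A generalized inverse of \<open>cum\<close>: the position of the unit of index
  \<open>i\<close> in class \<open>r\<close>, counted from the lowest.\<close>

definition item_pos :: "nat \<Rightarrow> (nat \<Rightarrow> nat) \<Rightarrow> nat \<Rightarrow> nat \<Rightarrow> nat" where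
  "item_pos m d r i = (LEAST n. i < cum m d r (Suc n))"

text \<open>Setting the digits above position \<open>L\<close> to \<open>p - 1\<close> makes every class of items infinite.\<close>

definition extend :: "nat \<Rightarrow> nat \<Rightarrow> (nat \<Rightarrow> nat) \<Rightarrow> nat \<Rightarrow> nat" where
  "extend p L d n = (if n < L then d n else p - 1)"

lemma cum_extend: "n \<le> L \<Longrightarrow> cum m (extend p L d) r n = cum m d r n"
  unfolding cum_def by (intro sum.cong) (auto simp: extend_def)

context
  fixes p m L :: nat
  assumes p: "2 \<le> p" and m: "0 < m"
begin

lemma cum_extend_unbounded:
  assumes "r < m"
  shows "i \<le> cum m (extend p L d) r (L * m + r + i * m)"
proof (induction i)
  case (Suc i)
  define n where "n = L * m + r + i * m"
  have "L \<le> n" using m unfolding n_def by (cases m) auto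
  moreover have "n mod m = r" using assms by (simp add: n_def)
  ultimately have "Suc (cum m (extend p L d) r n) \<le> cum m (extend p L d) r (Suc n)"
    using p by (simp add: cum_Suc extend_def)
  also have "\<dots> \<le> cum m (extend p L d) r (L * m + r + Suc i * m)"
    using m by (intro cum_mono) (simp add: n_def)
  finally show ?case using Suc by (simp add: n_def)
qed simp

text \<open>The Galois connection between positions and counts; unboundedness of \<open>cum\<close>
  on extended digits guarantees that the \<open>LEAST\<close> exists.\<close>

lemma item_pos_less_iff:
  assumes "r < m"
  shows "item_pos m (extend p L d) r i < n \<longleftrightarrow> i < cum m (extend p L d) r n"
proof
  let ?c = "cum m (extend p L d) r"
  have "Suc i \<le> ?c (Suc (L * m + r + Suc i * m))"
    by (rule le_trans[OF cum_extend_unbounded[OF assms, where d = d]]) (intro cum_mono, simp)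
  hence ex: "\<exists>n. i < ?c (Suc n)" by (intro exI[of _ "L * m + r + Suc i * m"]) simp
  {
    assume "item_pos m (extend p L d) r i < n"
    moreover have "i < ?c (Suc (item_pos m (extend p L d) r i))"
      unfolding item_pos_def by (rule LeastI_ex[OF ex])
    ultimately show "i < ?c n" using cum_mono[of "Suc (item_pos m (extend p L d) r i)" n] by (meson Suc_leI less_le_trans)
  }
  assume a: "i < ?c n"
  then obtain n' where "n = Suc n'" by (cases n) (auto simp: cum_0)
  thus "item_pos m (extend p L d) r i < n"
    using a Least_le[of "\<lambda>n. i < ?c (Suc n)" n'] by (simp add: item_pos_def)
qed

lemma cum_item_pos:
  assumes "r < m"
  shows "cum m (extend p L d) r (item_pos m (extend p L d) r i) \<le> i"
    and "i < cum m (extend p L d) r (Suc (item_pos m (extend p L d) r i))"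
  using item_pos_less_iff[OF assms, of d i "item_pos m (extend p L d) r i"]
    item_pos_less_iff[OF assms, of d i "Suc (item_pos m (extend p L d) r i)"] by auto

lemma packing_item_pos:
  assumes "\<And>n. d n < p"
  shows "packing p m (item_pos m (extend p L d))"
proof
  fix r i i' assume r: "r < m"
  let ?c = "cum m (extend p L d) r" and ?P = "item_pos m (extend p L d) r"
  note c = cum_item_pos[OF r, where d = d] and iff = item_pos_less_iff[OF r, where d = d]
  show "?P i mod m = r"
    using c[of i] by (auto simp: cum_Suc split: if_splits)
  show "?P i \<le> ?P i'" if "i \<le> i'"
    using iff[of i "Suc (?P i')"] c(2)[of i'] that by simp
  have "extend p L d n \<le> p - 1" for n using assms[of n] unfolding extend_def by (cases "n < L") auto
  hence "?c (Suc (?P i)) \<le> ?c (?P i) + (p - 1)" by (simp add: cum_Suc)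
  hence "\<not> i + (p - 1) < ?c (Suc (?P i))" using c(1)[of i] by simp
  thus "?P i < ?P (i + (p - 1))" using iff[of "i + (p - 1)" "Suc (?P i)"] by simp
qed (use p m in auto)

lemma sum_item_pos:
  assumes "r < m"
  shows "(\<Sum>i<cum m (extend p L d) r n. p ^ item_pos m (extend p L d) r i)
       = (\<Sum>k<n. if k mod m = r then extend p L d k * p ^ k else 0)"
proof (induction n)
  case (Suc n)
  let ?c = "cum m (extend p L d) r" and ?P = "item_pos m (extend p L d) r"
  have "?P i = n" if "?c n \<le> i" "i < ?c (Suc n)" for i
    using item_pos_less_iff[OF assms, of d i n] item_pos_less_iff[OF assms, of d i "Suc n"] that by simp
  hence "(\<Sum>i\<in>{?c n..<?c (Suc n)}. p ^ ?P i) = (\<Sum>i\<in>{?c n..<?c (Suc n)}. p ^ n)"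
    by (intro sum.cong) auto
  also have "\<dots> = (if n mod m = r then extend p L d n * p ^ n else 0)" by (simp add: cum_Suc)
  finally have "(\<Sum>i\<in>{?c n..<?c (Suc n)}. p ^ ?P i) = (if n mod m = r then extend p L d n * p ^ n else 0)" .
  moreover have "(\<Sum>i<?c (Suc n). p ^ ?P i) = (\<Sum>i<?c n. p ^ ?P i) + (\<Sum>i\<in>{?c n..<?c (Suc n)}. p ^ ?P i)"
    unfolding lessThan_atLeast0
    by (intro sum.atLeastLessThan_concat[symmetric]) (auto intro: cum_mono)
  ultimately show ?case using Suc by simp
qed (simp add: cum_0)

lemma sum_digits_items:
  "(\<Sum>k<L. d k * p ^ k) = (\<Sum>r<m. \<Sum>i<cum m d r L. p ^ item_pos m (extend p L d) r i)"
proof -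
  have "(\<Sum>r<m. \<Sum>i<cum m d r L. p ^ item_pos m (extend p L d) r i)
      = (\<Sum>r<m. \<Sum>k<L. if k mod m = r then extend p L d k * p ^ k else 0)"
  proof (rule sum.cong[OF refl])
    fix r assume "r \<in> {..<m}"
    thus "(\<Sum>i<cum m d r L. p ^ item_pos m (extend p L d) r i)
        = (\<Sum>k<L. if k mod m = r then extend p L d k * p ^ k else 0)"
      using sum_item_pos[of r d L] by (simp add: cum_extend)
  qed
  also have "\<dots> = (\<Sum>k<L. \<Sum>r<m. if k mod m = r then extend p L d k * p ^ k else 0)"
    by (rule sum.swap)
  also have "\<dots> = (\<Sum>k<L. d k * p ^ k)"
    using m by (intro sum.cong) (auto simp: sum.delta' extend_def)
  finally show ?thesis ..
qed

text \<open>Fewer units below each position push the unit of a given index upwards; from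
  \<open>L\<close> on the two extensions agree.\<close>

lemma item_pos_antimono:
  assumes "\<And>n. n < L \<Longrightarrow> g n \<le> d n" "r < m"
  shows "item_pos m (extend p L d) r i \<le> item_pos m (extend p L g) r i"
proof -
  let ?n = "Suc (item_pos m (extend p L g) r i)"
  have "i < cum m (extend p L g) r ?n" by (rule cum_item_pos(2)[OF assms(2)])
  also have "\<dots> \<le> cum m (extend p L d) r ?n"
    unfolding cum_def using assms(1) by (intro sum_mono) (auto simp: extend_def)
  finally show ?thesis using item_pos_less_iff[OF assms(2), of d i ?n] by simp
qed

end

subsection \<open>Chains of exponents\<close>

definition step :: "nat \<Rightarrow> nat \<Rightarrow> nat \<Rightarrow> nat \<Rightarrow> bool" where
  "step p m j k \<longleftrightarrow> submask p k j \<and> k < j \<and> (p ^ m - 1) dvd (j - k)"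

primrec chains :: "nat \<Rightarrow> nat \<Rightarrow> nat \<Rightarrow> nat \<Rightarrow> nat list set" where
  "chains p m 0 j = {[]}"
| "chains p m (Suc e) j = {k # ks | k ks. step p m j k \<and> ks \<in> chains p m e k}"

lemma chains_iff:
  "ks \<in> chains p m e j \<longleftrightarrow>
    length ks = e \<and> (\<forall>s<e. step p m ((j # ks) ! s) ((j # ks) ! Suc s))"
proof (induction e arbitrary: j ks)
  case (Suc e)
  show ?case
  proof (cases ks)
    case (Cons k ks')
    have "(\<forall>s<Suc e. P s) \<longleftrightarrow> P 0 \<and> (\<forall>s<e. P (Suc s))" for P
      by (metis less_Suc_eq_0_disj Suc_less_eq zero_less_Suc)
    thus ?thesis using Suc[of ks' k] by (simp add: Cons) blast
  qed simp
qed auto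

text \<open>The base-\<open>p ^ m\<close> digit sum of \<open>p ^ i * x\<close>. The range
  \<open>n < x\<close> captures all digits because \<open>x < p ^ x\<close>.\<close>

definition digit_sum :: "nat \<Rightarrow> nat \<Rightarrow> nat \<Rightarrow> nat \<Rightarrow> nat" where
  "digit_sum p m i x = (\<Sum>n<x. digit p x n * p ^ ((n + i) mod m))"

lemma digit_sum_eq_sum:
  assumes "2 \<le> p" "x < p ^ L"
  shows "digit_sum p m i x = (\<Sum>n<L. digit p x n * p ^ ((n + i) mod m))"
proof -
  have "(\<Sum>n<x. digit p x n * p ^ ((n + i) mod m)) = (\<Sum>n<max L x. digit p x n * p ^ ((n + i) mod m))"
    using digit_eq_0[OF less_power_self[OF assms(1), of x]] by (intro sum.mono_neutral_left) auto
  also have "\<dots> = (\<Sum>n<L. digit p x n * p ^ ((n + i) mod m))"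
    using digit_eq_0[OF assms(2)] by (intro sum.mono_neutral_right) auto
  finally show ?thesis by (simp add: digit_sum_def)
qed

text \<open>Casting out \<open>p ^ m - 1\<close>: modulo this number a power of \<open>p\<close>
  depends only on its exponent modulo \<open>m\<close>.\<close>

lemma cong_digit_sum:
  assumes "2 \<le> p"
  shows "[p ^ i * x = digit_sum p m i x] (mod p ^ m - 1)"
proof -
  have "1 \<le> p ^ m" using assms by simp
  hence one: "[p ^ m = 1] (mod p ^ m - 1)" by (simp add: cong_altdef_nat)
  have pow: "[p ^ a = p ^ (a mod m)] (mod p ^ m - 1)" for a
  proof -
    have "p ^ a = (p ^ m) ^ (a div m) * p ^ (a mod m)"
      by (simp only: power_mult[symmetric] power_add[symmetric] mult_div_mod_eq)
    also have "[\<dots> = 1 ^ (a div m) * p ^ (a mod m)] (mod p ^ m - 1)"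
      by (intro cong_mult cong_pow one cong_refl)
    finally show ?thesis by simp
  qed
  have "p ^ i * x = p ^ i * (\<Sum>n<x. digit p x n * p ^ n)"
    using sum_digit[OF less_power_self[OF assms, of x]] by simp
  also have "\<dots> = (\<Sum>n<x. digit p x n * p ^ (n + i))"
    by (simp only: sum_distrib_left power_add mult_ac)
  also have "[\<dots> = digit_sum p m i x] (mod p ^ m - 1)"
    unfolding digit_sum_def by (intro cong_sum cong_mult cong_refl pow)
  finally show ?thesis .
qed

lemma digit_sum_pos:
  assumes "2 \<le> p" "0 < x"
  shows "0 < digit_sum p m i x"
proof (rule ccontr)
  assume "\<not> 0 < digit_sum p m i x"
  hence "digit p x n = 0" if "n < x" for n using that assms by (simp add: digit_sum_def)
  hence "(\<Sum>n<x. digit p x n * p ^ n) = 0" by simp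
  thus False using sum_digit[OF less_power_self[OF assms(1), of x]] assms(2) by simp
qed

lemma dvd_digit_sum_0_iff:
  assumes "2 \<le> p"
  shows "(p ^ m - 1) dvd digit_sum p m 0 x \<longleftrightarrow> (p ^ m - 1) dvd x"
  using cong_digit_sum[OF assms, of 0 x m] cong_dvd_iff by (metis mult_1 power_0)

lemma digit_sum_ge:
  assumes "2 \<le> p" "0 < x" "(p ^ m - 1) dvd x"
  shows "p ^ m - 1 \<le> digit_sum p m i x"
proof (rule dvd_imp_le)
  have "(p ^ m - 1) dvd p ^ i * x" using assms(3) by simp
  thus "(p ^ m - 1) dvd digit_sum p m i x" using cong_digit_sum[OF assms(1)] cong_dvd_iff by blast
qed (rule digit_sum_pos[OF assms(1,2)])

lemma digit_sum_diff:
  assumes "2 \<le> p" "submask p k j"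
  shows "digit_sum p m i j = digit_sum p m i k + digit_sum p m i (j - k)"
proof -
  have "k \<le> j" by (rule submask_diff[OF assms])
  hence L: "j < p ^ j" "k < p ^ j" "j - k < p ^ j"
    using less_power_self[OF assms(1), of j] by simp_all
  show ?thesis
    unfolding L[THEN digit_sum_eq_sum[OF assms(1)]] sum.distrib[symmetric] distrib_right[symmetric]
      submask_diff(2)[OF assms]
    using assms(2) by (intro sum.cong) (auto simp: submask_def)
qed

text \<open>Without borrows the digit sums of the steps add up, and each is a positive multiple of
  \<open>p ^ m - 1\<close> at every rotation.\<close>

lemma chains_digit_sum_ge:
  assumes "2 \<le> p" "chains p m e j \<noteq> {}"
  shows "e * (p ^ m - 1) \<le> digit_sum p m i j"
  using assms(2)
proof (induction e arbitrary: j)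
  case (Suc e)
  then obtain k where k: "step p m j k" "chains p m e k \<noteq> {}" by auto
  have "p ^ m - 1 \<le> digit_sum p m i (j - k)"
    using k(1) assms(1) by (intro digit_sum_ge) (auto simp: step_def)
  thus ?case using Suc.IH[OF k(2)] digit_sum_diff[OF assms(1), of k j m i] k(1) by (simp add: step_def)
qed simp

section \<open>Exponent chains versus packings\<close>

context
  fixes p m L j :: nat
  assumes p: "2 \<le> p" and m: "0 < m" and j: "j < p ^ L"
begin

interpretation packing p m "item_pos m (extend p L (digit p j))"
  using p m by (intro packing_item_pos digit_less) auto

definition classes :: "nat \<Rightarrow> nat \<Rightarrow> nat" where
  "classes x r = cum m (digit p x) r L"

lemma rot_classes: "x < p ^ L \<Longrightarrow> rot i (classes x) = digit_sum p m i x"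
  unfolding rot_def classes_def digit_sum_eq_sum[OF p]
  using sum_cum[OF m, of "digit p x" L "\<lambda>r. p ^ ((r + i) mod m)"] by (simp add: mod_add_left_eq)

lemma submask_less: "submask p x j \<Longrightarrow> x < p ^ L"
  using submask_diff(1)[OF p] j by (blast intro: le_less_trans)

lemma classes_diff:
  assumes "submask p x y"
  shows "classes y r = classes x r + classes (y - x) r"
  unfolding classes_def cum_def sum.distrib[symmetric] submask_diff(2)[OF p assms]
  using assms by (intro sum.cong) (auto simp: submask_def)

lemma val_item_le:
  assumes "submask p x j" "r < m"
  shows "val r i \<le> p ^ item_pos m (extend p L (digit p x)) r i"
  unfolding val_def using assms p m
  by (intro power_increasing item_pos_antimono) (auto simp: submask_def)

lemma items_eq:
  assumes "x < p ^ L"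
  shows "x = (\<Sum>r<m. \<Sum>i<classes x r. p ^ item_pos m (extend p L (digit p x)) r i)"
  using sum_digits_items[OF p m, of "digit p x" L] sum_digit[OF assms] by (simp add: classes_def)

text \<open>\<open>weight\<close> values the lowest units of \<open>j\<close>, and the unit of the
  same index in a submask lies at least as high.\<close>

lemma weight_classes_le:
  assumes "submask p x j"
  shows "weight (classes x) \<le> x"
proof -
  have "weight (classes x) \<le> (\<Sum>r<m. \<Sum>i<classes x r. p ^ item_pos m (extend p L (digit p x)) r i)"
    unfolding weight_def using val_item_le[OF assms] by (intro sum_mono) auto
  also have "\<dots> = x" using items_eq[OF submask_less[OF assms]] ..
  finally show ?thesis .
qed

lemma item_pos_eq:
  assumes "submask p x j" "weight (classes x) = x" "r < m" "i < classes x r"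
  shows "item_pos m (extend p L (digit p x)) r i = item_pos m (extend p L (digit p j)) r i"
proof -
  let ?v = "\<lambda>r i. p ^ item_pos m (extend p L (digit p x)) r i"
  have "(\<Sum>r<m. \<Sum>i<classes x r. val r i) = (\<Sum>r<m. \<Sum>i<classes x r. ?v r i)"
    using assms(2) items_eq[OF submask_less[OF assms(1)]] by (simp add: weight_def)
  hence "(\<Sum>i<classes x r. val r i) = (\<Sum>i<classes x r. ?v r i)"
    by (rule sum_mono_inv) (use assms val_item_le[OF assms(1)] in \<open>auto intro: sum_mono\<close>)
  hence "val r i = ?v r i"
    by (rule sum_mono_inv) (use assms val_item_le[OF assms(1)] in auto)
  thus ?thesis using p by (simp add: val_def)
qed

text \<open>A submask that attains the bound of \<open>weight_classes_le\<close> consists of the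
  lowest units of \<open>j\<close>, so its counts determine its units and thereby its
  digits.\<close>

lemma weight_classes_inject:
  assumes "submask p x j" "submask p y j" "weight (classes x) = x" "weight (classes y) = y"
    and eq: "\<And>r. r < m \<Longrightarrow> classes x r = classes y r"
  shows "x = y"
proof (rule digit_inject[OF assms(1,2)[THEN submask_less]])
  have le: "cum m (digit p u) r n \<le> cum m (digit p v) r n"
    if uv: "submask p u j" "submask p v j" "weight (classes u) = u" "weight (classes v) = v"
      "\<And>r. r < m \<Longrightarrow> classes u r = classes v r" and rn: "r < m" "n \<le> L" for u v r n
  proof (rule ccontr)
    assume neg: "\<not> ?thesis"
    define i where "i = cum m (digit p v) r n"
    have less: "i < cum m (digit p u) r n" using neg by (simp add: i_def)
    also have "\<dots> \<le> classes u r" unfolding classes_def using rn(2) by (rule cum_mono)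
    finally have i: "i < classes u r" "i < classes v r" using uv(5)[OF rn(1)] by simp_all
    have "item_pos m (extend p L (digit p u)) r i < n"
      using less item_pos_less_iff[OF p m rn(1), of L "digit p u" i n] rn(2) by (simp add: cum_extend)
    hence "item_pos m (extend p L (digit p v)) r i < n"
      using item_pos_eq[OF uv(1,3) rn(1) i(1)] item_pos_eq[OF uv(2,4) rn(1) i(2)] by simp
    thus False
      using item_pos_less_iff[OF p m rn(1), of L "digit p v" i n] rn(2) by (simp add: cum_extend i_def)
  qed
  have cum_eq: "cum m (digit p x) r n = cum m (digit p y) r n" if "r < m" "n \<le> L" for r n
    using le[OF assms(1-4) eq that] le[OF assms(2,1,4,3) eq[symmetric] that] by simp
  fix n assume "n < L"
  thus "digit p x n = digit p y n"
    using cum_eq[of "n mod m" "Suc n"] cum_eq[of "n mod m" n] m by (simp add: cum_Suc)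
qed

text \<open>The share of digit \<open>n\<close> of \<open>j\<close> when only the \<open>c r\<close>
  lowest units of each class \<open>r\<close> are kept.\<close>

definition lowest_digit :: "(nat \<Rightarrow> nat) \<Rightarrow> nat \<Rightarrow> nat" where
  "lowest_digit c n = min (cum m (digit p j) (n mod m) (Suc n)) (c (n mod m))
     - min (cum m (digit p j) (n mod m) n) (c (n mod m))"

definition lowest :: "(nat \<Rightarrow> nat) \<Rightarrow> nat" where
  "lowest c = (\<Sum>n<L. lowest_digit c n * p ^ n)"

lemma lowest_digit_le: "lowest_digit c n \<le> digit p j n"
proof -
  have "min (a + d) x - min a x \<le> d" for a d x :: nat by linarith
  thus ?thesis by (simp add: lowest_digit_def cum_Suc)
qed

lemma digit_lowest: "digit p (lowest c) n = (if n < L then lowest_digit c n else 0)"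
  unfolding lowest_def
  by (intro digit_sum_eq(2) le_less_trans[OF lowest_digit_le] digit_less) (use p in auto)

lemma submask_lowest: "submask p (lowest c) j"
  using lowest_digit_le by (auto simp: submask_def digit_lowest)

lemma submask_lowest_mono:
  assumes "\<And>r. r < m \<Longrightarrow> c r \<le> c' r"
  shows "submask p (lowest c) (lowest c')"
proof -
  have "min (a + d) x - min a x \<le> min (a + d) y - min a y" if "x \<le> y" for a d x y :: nat
    using that by linarith
  hence "lowest_digit c n \<le> lowest_digit c' n" for n
    using assms[of "n mod m"] m by (simp add: lowest_digit_def cum_Suc)
  thus ?thesis by (simp add: submask_def digit_lowest)
qed

lemma cum_lowest:
  assumes "r < m" "n \<le> L"
  shows "cum m (digit p (lowest c)) r n = min (cum m (digit p j) r n) (c r)"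
  using assms(2)
proof (induction n)
  case (Suc n)
  have "cum m (digit p j) r n \<le> cum m (digit p j) r (Suc n)" by (rule cum_mono) simp
  thus ?case using Suc by (auto simp: cum_Suc digit_lowest lowest_digit_def)
qed (simp add: cum_0)

lemma classes_lowest:
  assumes "r < m" "c r \<le> classes j r"
  shows "classes (lowest c) r = c r"
  using cum_lowest[OF assms(1), of L c] assms(2) by (simp add: classes_def)

lemma weight_lowest:
  assumes "\<And>r. r < m \<Longrightarrow> c r \<le> classes j r"
  shows "weight c = lowest c"
proof -
  have "item_pos m (extend p L (digit p (lowest c))) r i = item_pos m (extend p L (digit p j)) r i"
    if r: "r < m" "i < c r" for r i
  proof -
    let ?P = "\<lambda>d. item_pos m (extend p L (digit p d)) r i"
    have less: "?P (lowest c) < n \<longleftrightarrow> ?P j < n" if "n \<le> L" for n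
      using that r cum_lowest[OF r(1) that, of c]
      by (simp add: item_pos_less_iff[OF p m r(1)] cum_extend)
    have "?P j < L"
      using r assms[OF r(1)] by (simp add: item_pos_less_iff[OF p m r(1)] cum_extend classes_def)
    hence "?P (lowest c) < L" using less[of L] by simp
    thus ?thesis using less[of "Suc (?P j)"] less[of "Suc (?P (lowest c))"] \<open>?P j < L\<close> by simp
  qed
  hence "weight c = (\<Sum>r<m. \<Sum>i<c r. p ^ item_pos m (extend p L (digit p (lowest c))) r i)"
    unfolding weight_def val_def by (intro sum.cong) auto
  also have "\<dots> = (\<Sum>r<m. \<Sum>i<classes (lowest c) r. p ^ item_pos m (extend p L (digit p (lowest c))) r i)"
    using classes_lowest assms by (intro sum.cong) auto
  also have "\<dots> = lowest c" using items_eq[OF submask_less[OF submask_lowest]] ..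
  finally show ?thesis .
qed

lemma chain_of_chains:
  assumes ks: "ks \<in> chains p m e j" and lt: "digit_sum p m 0 j < Suc e * (p ^ m - 1)"
  defines "K \<equiv> (\<lambda>t. (j # ks) ! t)"
  defines "b \<equiv> (\<lambda>s. classes (K s - K (Suc s)))"
  shows "chain e (classes j) b"
    and "t \<le> e \<Longrightarrow> submask p (K t) j"
    and "t \<le> e \<Longrightarrow> cnt b t r = classes (j - K t) r"
proof -
  define q where "q = p ^ m - 1"
  define a where "a s = digit_sum p m 0 (K s - K (Suc s))" for s
  have st: "step p m (K s) (K (Suc s))" if "s < e" for s
    using ks that unfolding chains_iff K_def by blast
  have K0: "K 0 = j" by (simp add: K_def)
  have sub: "submask p (K t) j" if "t \<le> e" for t
    using that
  proof (induction t)
    case (Suc t)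
    hence "submask p (K (Suc t)) (K t)" using st[of t] by (simp add: step_def)
    thus ?case using Suc by (auto simp: submask_def intro: le_trans)
  qed (simp add: K0 submask_def)
  thus "t \<le> e \<Longrightarrow> submask p (K t) j" .
  have "cnt b t r + classes (K t) r = classes j r" if "t \<le> e" for t r
    using that
  proof (induction t)
    case (Suc t)
    have "classes (K t) r = classes (K (Suc t)) r + b t r"
      unfolding b_def using st[of t] Suc.prems by (intro classes_diff) (simp add: step_def)
    thus ?case using Suc by (simp add: cnt_Suc)
  qed (simp add: cnt_def K0)
  thus cnt_eq: "cnt b t r = classes (j - K t) r" if "t \<le> e" for t r
    using classes_diff[OF sub[OF that], of r] that by (metis add.commute add_left_cancel)
  have total: "digit_sum p m 0 j = (\<Sum>s<t. a s) + digit_sum p m 0 (K t)" if "t \<le> e" for t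
    using that
  proof (induction t)
    case (Suc t)
    have "digit_sum p m 0 (K t) = digit_sum p m 0 (K (Suc t)) + a t"
      unfolding a_def using st[of t] Suc.prems p by (intro digit_sum_diff) (auto simp: step_def)
    thus ?case using Suc by simp
  qed (simp add: K0)
  have dvd: "q dvd a s" and ge: "q \<le> a s" if "s < e" for s
    using st[OF that] digit_sum_ge[OF p, of "K s - K (Suc s)" m 0] dvd_digit_sum_0_iff[OF p]
    by (simp_all add: a_def q_def step_def)
  \<comment> \<open>The \<open>e\<close> digit sums are positive multiples of \<open>q\<close>; one
    that is at least \<open>2 * q\<close> would push the total to \<open>Suc e * q\<close>.\<close>
  have a_eq: "a s = q" if s: "s < e" for s
  proof (rule ccontr)
    assume "a s \<noteq> q"
    moreover obtain x where x: "a s = q * x" using dvd[OF s] by (auto elim: dvdE)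
    moreover have "0 < q" using lt by (auto simp: q_def intro: ccontr)
    ultimately have "x \<noteq> 1" "x \<noteq> 0" using ge[OF s] by auto
    hence "2 \<le> x" by simp
    hence "2 * q \<le> a s" using x by simp
    moreover have "(\<Sum>s\<in>{..<e} - {s}. q) \<le> (\<Sum>s\<in>{..<e} - {s}. a s)"
      using ge by (intro sum_mono) auto
    moreover have "(\<Sum>s<e. a s) = a s + (\<Sum>s\<in>{..<e} - {s}. a s)"
      using that by (intro sum.remove) auto
    ultimately have "2 * q + (e - 1) * q \<le> digit_sum p m 0 j"
      using total[of e] that by simp
    moreover have "2 * q + (e - 1) * q = Suc e * q" using that by (cases e) auto
    ultimately show False using lt by (simp add: q_def)
  qed
  show "chain e (classes j) b"
    unfolding chain_def
  proof (intro conjI allI impI)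
    fix s assume s: "s < e"
    have "K s - K (Suc s) < p ^ L"
      using submask_less[OF sub[of s]] s by (simp add: less_imp_diff_less)
    thus "low m (b s) = p ^ m - 1"
      using a_eq[OF s] by (simp add: b_def a_def q_def rot_0[symmetric] rot_classes)
  next
    fix r
    show "cnt b e r \<le> classes j r"
      using cnt_eq[of e r] classes_diff[OF sub[of e], of r] by simp
  qed
qed

text \<open>Conversely, the \<open>t\<close>-th exponent arises from \<open>j\<close> by removing
  its lowest units in the amounts used by the first \<open>t\<close> bins.\<close>

lemma chains_of_chain:
  assumes "chain e (classes j) b"
  defines "ks \<equiv> map (\<lambda>t. j - lowest (cnt b t)) [1..<Suc e]"
  shows "ks \<in> chains p m e j"
    and "t \<le> e \<Longrightarrow> (j # ks) ! t = j - lowest (cnt b t)"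
proof -
  have "lowest (cnt b 0) = 0" by (simp add: lowest_def lowest_digit_def cnt_def)
  thus K: "(j # ks) ! t = j - lowest (cnt b t)" if "t \<le> e" for t
    unfolding ks_def using that by (cases t) (auto simp del: upt_Suc)
  have cnt_le: "cnt b t r \<le> classes j r" if "t \<le> e" "r < m" for t r
    using assms(1) cnt_mono[OF that(1), of b r] that(2) by (auto simp: chain_def intro: le_trans)
  show "ks \<in> chains p m e j"
    unfolding chains_iff
  proof (intro conjI allI impI)
    show "length ks = e" by (simp add: ks_def)
    fix s assume s: "s < e"
    define x where "x = lowest (cnt b s)"
    define y where "y = lowest (cnt b (Suc s))"
    have xy: "submask p x y" unfolding x_def y_def by (intro submask_lowest_mono cnt_mono) simp
    have sub: "submask p x j" "submask p y j" by (simp_all add: x_def y_def submask_lowest)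
    note le = xy[THEN submask_diff(1)[OF p]] sub[THEN submask_diff(1)[OF p]]
    have "classes (y - x) r = b s r" if "r < m" for r
      using classes_diff[OF xy, of r] classes_lowest[of r "cnt b s"] classes_lowest[of r "cnt b (Suc s)"]
        cnt_le[of s r] cnt_le[of "Suc s" r] s that by (simp add: x_def y_def cnt_Suc)
    hence "low m (classes (y - x)) = p ^ m - 1"
      using low_cong[of m "classes (y - x)" "b s"] assms(1) s by (simp add: chain_def)
    moreover have "y - x < p ^ L" using submask_less[OF sub(2)] by (simp add: less_imp_diff_less)
    ultimately have ds: "digit_sum p m 0 (y - x) = p ^ m - 1"
      by (simp add: rot_classes[symmetric] rot_0)
    hence "(p ^ m - 1) dvd (y - x)" using dvd_digit_sum_0_iff[OF p, of m "y - x"] by simp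
    moreover have "0 < y - x"
    proof (rule ccontr)
      assume "\<not> 0 < y - x"
      hence "p ^ m - 1 = 0" using ds by (simp add: digit_sum_def)
      moreover have "p \<le> p ^ m" using p m by (intro self_le_power) auto
      ultimately show False using p by simp
    qed
    moreover have "(j - x) - (j - y) = y - x" using le by simp
    \<comment> \<open>Complements in \<open>j\<close> reverse digitwise domination.\<close>
    moreover have "submask p (j - y) (j - x)"
      using xy by (simp add: submask_def submask_diff(2)[OF p sub(1)] submask_diff(2)[OF p sub(2)] diff_le_mono2)
    ultimately have "step p m (j - x) (j - y)" using le by (simp add: step_def)
    thus "step p m ((j # ks) ! s) ((j # ks) ! Suc s)"
      unfolding K[OF less_imp_le[OF s]] K[OF Suc_leI[OF s]] x_def y_def .
  qed
qed

text \<open>This turns maximality of the exponent sum into minimality of the total amount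
  removed.\<close>

lemma sum_list_chain:
  assumes "ks \<in> chains p m e j" "\<And>t. t \<le> e \<Longrightarrow> (j # ks) ! t \<le> j"
  shows "sum_list ks + (\<Sum>t\<in>{1..e}. j - (j # ks) ! t) = e * j"
proof -
  have len: "length ks = e" using assms(1) by (simp add: chains_iff)
  have "sum_list ks = (\<Sum>t<e. (j # ks) ! Suc t)"
    using len by (simp add: sum_list_sum_nth lessThan_atLeast0)
  also have "\<dots> = (\<Sum>t\<in>{1..e}. (j # ks) ! t)"
    by (simp add: sum.atLeast_Suc_atMost_Suc_shift sum.atLeast1_atMost_eq)
  finally have "sum_list ks + (\<Sum>t\<in>{1..e}. j - (j # ks) ! t)
      = (\<Sum>t\<in>{1..e}. (j # ks) ! t + (j - (j # ks) ! t))" by (simp add: sum.distrib)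
  also have "\<dots> = (\<Sum>t\<in>{1..e}. j)"
    by (intro sum.cong refl le_add_diff_inverse assms(2)) auto
  finally show ?thesis by simp
qed

text \<open>An optimal packing yields \<open>ks0\<close>. A rival with no smaller sum induces a
  packing of no larger cost, hence an optimal one with the same prefix counts. Equality of the costs
  forces the rival to remove lowest units too, so it equals \<open>ks0\<close>.\<close>

lemma unique_maximal_chain_aux:
  assumes ge: "\<And>i. i < m \<Longrightarrow> e * (p ^ m - 1) \<le> digit_sum p m i j"
    and lt: "digit_sum p m 0 j < Suc e * (p ^ m - 1)"
  shows "\<exists>ks0\<in>chains p m e j. \<forall>ks\<in>chains p m e j. ks \<noteq> ks0 \<longrightarrow> sum_list ks < sum_list ks0"
proof -
  have "\<exists>b. chain e (classes j) b"
    by (rule chain_exists) (use ge lt in \<open>simp_all only: rot_classes[OF j]\<close>)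
  then obtain b where "chain e (classes j) b" ..
  then obtain b0 where opt: "optimal e (classes j) b0" by (rule optimal_exists)
  hence b0: "chain e (classes j) b0" by (simp add: optimal_def)
  define ks0 where "ks0 = map (\<lambda>t. j - lowest (cnt b0 t)) [1..<Suc e]"
  note ks0 = chains_of_chain[OF b0, folded ks0_def]
  have low_le: "lowest c \<le> j" for c using submask_diff(1)[OF p submask_lowest] .
  have cnt_le: "cnt b0 t r \<le> classes j r" if "t \<le> e" "r < m" for t r
    using b0 cnt_mono[OF that(1), of b0 r] that(2) by (auto simp: chain_def intro: le_trans)
  have w0: "weight (cnt b0 t) = lowest (cnt b0 t)" if "t \<le> e" for t
    using cnt_le[OF that] by (rule weight_lowest)
  have "(\<Sum>t\<in>{1..e}. j - (j # ks0) ! t) = cost e b0"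
    unfolding cost_def
  proof (intro sum.cong refl)
    fix t assume "t \<in> {1..e}"
    hence t: "t \<le> e" by simp
    show "j - (j # ks0) ! t = weight (cnt b0 t)"
      unfolding ks0(2)[OF t] w0[OF t] using low_le by simp
  qed
  hence sum0: "sum_list ks0 + cost e b0 = e * j"
    using sum_list_chain[OF ks0(1)] ks0(2) by simp
  have "sum_list ks < sum_list ks0" if ks: "ks \<in> chains p m e j" "ks \<noteq> ks0" for ks
  proof (rule ccontr)
    assume neg: "\<not> sum_list ks < sum_list ks0"
    define K where "K t = (j # ks) ! t" for t
    define b where "b = (\<lambda>s. classes (K s - K (Suc s)))"
    note chain = chain_of_chains[OF ks(1) lt, folded K_def, folded b_def]
    have sub: "submask p (j - K t) j" if "t \<le> e" for t
      using chain(2)[OF that] submask_diff(2)[OF p chain(2)[OF that]] by (simp add: submask_def)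
    have K_le: "K t \<le> j" if "t \<le> e" for t using submask_diff(1)[OF p chain(2)[OF that]] .
    have cnt: "weight (cnt b t) = weight (classes (j - K t))" if "t \<le> e" for t
      using chain(3)[OF that] by (intro weight_cong)
    have w_le: "weight (cnt b t) \<le> j - K t" if "t \<le> e" for t
      unfolding cnt[OF that] by (rule weight_classes_le[OF sub[OF that]])
    hence le: "cost e b \<le> (\<Sum>t\<in>{1..e}. j - K t)"
      unfolding cost_def by (intro sum_mono) auto
    moreover have "sum_list ks + (\<Sum>t\<in>{1..e}. j - K t) = e * j"
      using sum_list_chain[OF ks(1)] K_le unfolding K_def by blast
    moreover have "cost e b0 \<le> cost e b" using opt chain(1) by (simp add: optimal_def)
    ultimately have eq: "cost e b = cost e b0" "(\<Sum>t\<in>{1..e}. j - K t) = cost e b"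
      using neg sum0 by simp_all
    hence optb: "optimal e (classes j) b" using opt chain(1) by (simp add: optimal_def)
    have "ks = ks0"
    proof (rule nth_equalityI)
      show "length ks = length ks0" using ks(1) ks0(1) by (simp add: chains_iff)
      fix s assume "s < length ks"
      hence s: "s < e" using ks(1) by (simp add: chains_iff)
      hence t: "Suc s \<in> {1..e}" "Suc s \<le> e" by auto
      have "weight (cnt b (Suc s)) = j - K (Suc s)"
        by (rule sum_mono_inv[OF eq(2)[symmetric, unfolded cost_def] _ t(1)]) (use w_le in auto)
      hence w: "weight (classes (j - K (Suc s))) = j - K (Suc s)" using cnt[OF t(2)] by simp
      have cl: "classes (lowest (cnt b0 (Suc s))) r = cnt b0 (Suc s) r" if "r < m" for r
        using cnt_le[OF t(2) that] by (rule classes_lowest[OF that])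
      have "j - K (Suc s) = lowest (cnt b0 (Suc s))"
      proof (rule weight_classes_inject[OF sub[OF t(2)] submask_lowest w])
        show "weight (classes (lowest (cnt b0 (Suc s)))) = lowest (cnt b0 (Suc s))"
          using w0[OF t(2)] weight_cong[OF cl] by simp
        show "classes (j - K (Suc s)) r = classes (lowest (cnt b0 (Suc s))) r" if "r < m" for r
          using cl[OF that] optimal_unique[OF optb opt t(2) that] chain(3)[OF t(2), of r] by simp
      qed
      hence "K (Suc s) = j - lowest (cnt b0 (Suc s))" using K_le[OF t(2)] by simp
      thus "ks ! s = ks0 ! s" using ks0(2)[OF t(2)] by (simp add: K_def)
    qed
    thus False using ks(2) by simp
  qed
  thus ?thesis using ks0(1) by blast
qed

end

lemma unique_maximal_chain:
  assumes "2 \<le> p" "0 < m"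
    and "\<And>i. i < m \<Longrightarrow> e * (p ^ m - 1) \<le> digit_sum p m i j"
    and "digit_sum p m 0 j < Suc e * (p ^ m - 1)"
  shows "\<exists>ks0\<in>chains p m e j. \<forall>ks\<in>chains p m e j. ks \<noteq> ks0 \<longrightarrow> sum_list ks < sum_list ks0"
  using unique_maximal_chain_aux[OF assms(1,2) less_power_self[OF assms(1)] assms(3,4)] .

subsection \<open>Power sums\<close>

lemma CHAR_eq_prime:
  assumes "prime p" "CARD('a::{field, finite}) = p ^ m"
  shows "CHAR('a) = p"
proof -
  have "of_nat p ^ m = (0 :: 'a)" using of_nat_CARD_eq_0[where ?'a = 'a] assms(2) by simp
  hence "of_nat p = (0 :: 'a)" by simp
  hence "CHAR('a) dvd p" by (simp add: of_nat_eq_0_iff_char_dvd)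
  thus ?thesis using assms(1) by (metis CHAR_not_1 One_nat_def prime_nat_iff)
qed

lemma coeff_one_plus_monom_power:
  assumes "0 < d"
  shows "coeff ((1 + monom (1 :: 'a::comm_ring_1) d) ^ n) i
       = (if d dvd i then of_nat (n choose (i div d)) else 0)"
proof -
  have "(1 + monom (1 :: 'a) d) ^ n = (\<Sum>k\<le>n. of_nat (n choose k) * monom 1 d ^ k * 1 ^ (n - k))"
    unfolding add.commute[of 1] by (rule binomial_ring)
  also have "\<dots> = (\<Sum>k\<le>n. monom (of_nat (n choose k)) (d * k))"
    by (intro sum.cong) (auto simp: monom_power of_nat_poly smult_monom)
  finally have "coeff ((1 + monom (1 :: 'a) d) ^ n) i
      = (\<Sum>k\<le>n. if d * k = i then of_nat (n choose k) else 0)"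
    by (simp add: coeff_sum)
  also have "\<dots> = (if d dvd i then of_nat (n choose (i div d)) else 0)"
  proof (cases "d dvd i")
    case True
    then obtain k' where k': "i = d * k'" by blast
    have "(\<Sum>k\<le>n. if d * k = i then of_nat (n choose k) else (0 :: 'a))
        = (\<Sum>k\<le>n. if k = k' then of_nat (n choose k) else 0)"
      using assms k' by (intro sum.cong) auto
    also have "\<dots> = of_nat (n choose k')" by (simp add: sum.delta binomial_eq_0)
    finally show ?thesis using k' assms by simp
  next
    case False
    have "(\<Sum>k\<le>n. if d * k = i then of_nat (n choose k) else (0 :: 'a)) = 0"
      using False by (intro sum.neutral) auto
    thus ?thesis using False by simp
  qed
  finally show ?thesis .
qed

text \<open>Compare coefficients in
  \<open>(1 + X) ^ (p * a + b) = (1 + X ^ p) ^ a * (1 + X) ^ b\<close>. Only the index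
  \<open>p * c\<close> contributes: the first factor needs a multiple of \<open>p\<close>, and the
  second has degree less than \<open>p\<close>.\<close>

lemma lucas_step:
  assumes "prime p" "CHAR('a::field) = p" "b < p" "d < p"
  shows "(of_nat ((p * a + b) choose (p * c + d)) :: 'a) = of_nat (a choose c) * of_nat (b choose d)"
proof -
  have p: "0 < p" using assms(1) by (rule prime_gt_0_nat)
  let ?X = "\<lambda>d. 1 + monom (1 :: 'a) d"
  have "?X 1 ^ p = 1 ^ p + monom 1 1 ^ p"
    using assms(1,2) by (intro freshmans_dream) auto
  hence frob: "?X 1 ^ p = ?X p" by (simp add: monom_power)
  have "(of_nat ((p * a + b) choose (p * c + d)) :: 'a) = coeff (?X 1 ^ (p * a + b)) (p * c + d)"
    by (subst coeff_one_plus_monom_power) auto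
  also have "?X 1 ^ (p * a + b) = ?X p ^ a * ?X 1 ^ b"
    by (simp only: power_add power_mult frob)
  also have "coeff \<dots> (p * c + d)
      = (\<Sum>i\<le>p * c + d. coeff (?X p ^ a) i * coeff (?X 1 ^ b) (p * c + d - i))"
    by (rule coeff_mult)
  also have "\<dots> = (\<Sum>i\<in>{p * c}. coeff (?X p ^ a) i * coeff (?X 1 ^ b) (p * c + d - i))"
  proof (intro sum.mono_neutral_right ballI)
    fix i assume i: "i \<in> {..p * c + d} - {p * c}"
    show "coeff (?X p ^ a) i * coeff (?X 1 ^ b) (p * c + d - i) = 0"
    proof (cases "p dvd i")
      case True
      then obtain k where k: "i = p * k" by blast
      have "p * k \<le> p * c + d" using i k by simp
      hence "p * k < p * Suc c" using assms(4) by simp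
      hence "k \<le> c" by (simp only: mult_less_cancel1 less_Suc_eq_le)
      moreover have "k \<noteq> c" using i k by auto
      ultimately have "p * Suc k \<le> p * c" by (intro mult_le_mono2) simp
      hence "b < p * c + d - i" using assms(3) k by simp
      thus ?thesis by (simp only: coeff_one_plus_monom_power[OF zero_less_one]) (simp add: binomial_eq_0)
    next
      case False
      thus ?thesis using p by (simp add: coeff_one_plus_monom_power)
    qed
  qed auto
  also have "\<dots> = of_nat (a choose c) * of_nat (b choose d)"
    using p by (simp add: coeff_one_plus_monom_power del: One_nat_def)
  finally show ?thesis .
qed

lemma of_nat_binomial_digit_eq_0_iff:
  assumes "prime p" "CHAR('a::field) = p" "b < p"
  shows "(of_nat (b choose d) :: 'a) = 0 \<longleftrightarrow> b < d"
proof (cases "b < d")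
  case False
  hence "(b choose d) dvd fact b" using choose_dvd[of d b] binomial_fact_lemma[of d b] by (metis dvd_triv_right not_less)
  moreover have "\<not> p dvd fact b" using prime_dvd_fact_iff[OF assms(1)] assms(3) by simp
  ultimately have "\<not> p dvd (b choose d)" using dvd_trans by blast
  thus ?thesis using False assms(2) by (simp add: of_nat_eq_0_iff_char_dvd)
qed (simp add: binomial_eq_0)

lemma submask_iff:
  "submask p k j \<longleftrightarrow> k mod p \<le> j mod p \<and> submask p (k div p) (j div p)"
proof
  assume *: "k mod p \<le> j mod p \<and> submask p (k div p) (j div p)"
  show "submask p k j"
    unfolding submask_def
  proof
    fix n show "digit p k n \<le> digit p j n"
      using * by (cases n) (auto simp: submask_def digit_0 digit_Suc)
  qed
qed (auto simp: submask_def digit_0[symmetric] digit_Suc[symmetric])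

lemma of_nat_binomial_neq_0_iff:
  assumes "prime p" "CHAR('a::field) = p"
  shows "(of_nat (j choose k) :: 'a) \<noteq> 0 \<longleftrightarrow> submask p k j"
proof (induction j arbitrary: k rule: less_induct)
  case (less j)
  have p: "2 \<le> p" using assms(1) by (rule prime_ge_2_nat)
  show ?case
  proof (cases "j = 0")
    case True
    show ?thesis
    proof (cases "k = 0")
      case False
      hence "\<not> submask p k 0" using submask_diff(1)[OF p, of k 0] by auto
      thus ?thesis using True False by (simp add: binomial_eq_0)
    qed (simp add: True submask_def)
  next
    case False
    have "(of_nat (j choose k) :: 'a) = of_nat ((j div p) choose (k div p)) * of_nat ((j mod p) choose (k mod p))"
      using lucas_step[OF assms, of "j mod p" "k mod p" "j div p" "k div p"] p by simp
    moreover have "(of_nat ((j mod p) choose (k mod p)) :: 'a) = 0 \<longleftrightarrow> j mod p < k mod p"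
      using of_nat_binomial_digit_eq_0_iff[OF assms, of "j mod p" "k mod p"] p by simp
    moreover have "(of_nat ((j div p) choose (k div p)) :: 'a) \<noteq> 0 \<longleftrightarrow> submask p (k div p) (j div p)"
      using False p by (intro less.IH) simp
    ultimately show ?thesis unfolding submask_iff[of p k j] by (auto simp: not_less)
  qed
qed

section \<open>Recursion and chain expansion of the power sums\<close>

lemma power_CARD_minus_1:
  assumes "a \<noteq> (0 :: 'a::{field, finite})"
  shows "a ^ (CARD('a) - 1) = 1"
proof -
  let ?U = "UNIV - {0 :: 'a}"
  have "bij_betw ((*) a) ?U ?U"
    using assms by (intro bij_betwI[where g = "\<lambda>x. x / a"]) auto
  hence "(\<Prod>x\<in>?U. a * x) = (\<Prod>x\<in>?U. x)" by (rule prod.reindex_bij_betw)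
  hence "a ^ card ?U * (\<Prod>x\<in>?U. x) = 1 * (\<Prod>x\<in>?U. x)" by (simp add: prod.distrib)
  moreover have "(\<Prod>x\<in>?U. x) \<noteq> 0" by simp
  ultimately have "a ^ card ?U = 1" using mult_right_cancel by blast
  thus ?thesis by (simp add: card_Diff_singleton)
qed

text \<open>If \<open>CARD('a) - 1\<close> does not divide \<open>n\<close>, some nonzero
  \<open>g\<close> has \<open>g ^ n \<noteq> 1\<close>, as \<open>X ^ r - 1\<close> has at most
  \<open>r\<close> roots; multiplication by \<open>g\<close> permutes the field, so the sum
  vanishes. For \<open>n = 0\<close> the term \<open>0 ^ 0 = 1\<close> makes the sum
  \<open>CARD('a)\<close>, which is zero.\<close>

lemma sum_powers_field:
  "(\<Sum>a\<in>UNIV. a ^ n) = (if 0 < n \<and> (CARD('a) - 1) dvd n then - 1 else (0 :: 'a::{field, finite}))"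
proof (cases "n = 0")
  case True
  thus ?thesis by (simp add: of_nat_CARD_eq_0)
next
  case n: False
  define Q where "Q = CARD('a) - 1"
  have red: "a ^ n = a ^ (n mod Q)" if "a \<noteq> 0" for a :: 'a
  proof -
    have "a ^ n = (a ^ Q) ^ (n div Q) * a ^ (n mod Q)"
      by (simp only: power_mult[symmetric] power_add[symmetric] mult_div_mod_eq)
    thus ?thesis using power_CARD_minus_1[OF that] by (simp add: Q_def)
  qed
  show ?thesis
  proof (cases "Q dvd n")
    case True
    have "(\<Sum>a\<in>UNIV. a ^ n) = (\<Sum>a\<in>UNIV - {0 :: 'a}. a ^ n)"
      using n by (intro sum.mono_neutral_right) auto
    also have "\<dots> = (\<Sum>a\<in>UNIV - {0 :: 'a}. 1)"
      using red True by (intro sum.cong) auto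
    also have "\<dots> = of_nat (CARD('a) - 1)" by (simp add: card_Diff_singleton)
    also have "\<dots> = - (1 :: 'a)" by (simp add: of_nat_diff of_nat_CARD_eq_0 Suc_leI)
    finally show ?thesis using True n by (simp add: Q_def)
  next
    case False
    define r where "r = n mod Q"
    have "{0 :: 'a, 1} \<subseteq> UNIV" by simp
    hence "card {0 :: 'a, 1} \<le> CARD('a)" by (intro card_mono) auto
    hence Q: "0 < Q" by (simp add: Q_def)
    have r: "0 < r" "r < Q" using False Q by (auto simp: r_def dvd_eq_mod_eq_0)
    define P where "P = monom (1 :: 'a) r - 1"
    have "coeff P r = 1" using r by (simp add: P_def)
    hence P: "P \<noteq> 0" by auto
    have "degree P \<le> r" unfolding P_def by (intro degree_diff_le) (auto simp: degree_monom_le)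
    hence "card {x. poly P x = 0} < card (UNIV - {0 :: 'a})"
      using card_poly_roots_bound[OF P] r by (simp add: Q_def card_Diff_singleton)
    hence "\<not> UNIV - {0 :: 'a} \<subseteq> {x. poly P x = 0}"
      using card_mono[OF finite, of "UNIV - {0 :: 'a}" "{x. poly P x = 0}"] by linarith
    then obtain g where g: "g \<noteq> 0" "poly P g \<noteq> 0" by auto
    hence g1: "g ^ n \<noteq> 1" using red[of g] by (simp add: P_def poly_monom r_def)
    have "bij ((*) g)" using g(1) by (intro bij_betwI[where g = "\<lambda>x. x / g"]) simp_all
    hence "(\<Sum>a\<in>(UNIV :: 'a set). (g * a) ^ n) = (\<Sum>a\<in>(UNIV :: 'a set). a ^ n)" by (rule sum.reindex_bij_betw)
    hence "g ^ n * (\<Sum>a\<in>(UNIV :: 'a set). a ^ n) = (\<Sum>a\<in>(UNIV :: 'a set). a ^ n)"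
      by (simp add: power_mult_distrib sum_distrib_left)
    hence "(g ^ n - 1) * (\<Sum>a\<in>(UNIV :: 'a set). a ^ n) = 0" by (simp add: left_diff_distrib)
    hence "(\<Sum>a\<in>(UNIV :: 'a set). a ^ n) = 0" using g1 by simp
    thus ?thesis using False by (simp add: Q_def)
  qed
qed

lemma monic_polys_0: "monic_polys 0 = {1 :: 'a::field poly}"
  by (auto simp: monic_polys_def elim!: degree_eq_zeroE)

lemma monic_polys_Suc:
  "monic_polys (Suc e) = (\<lambda>(a, h). pCons a h) ` (UNIV \<times> (monic_polys e :: 'a::field poly set))"
proof (intro equalityI subsetI)
  fix f :: "'a poly" assume f: "f \<in> monic_polys (Suc e)"
  obtain a h where "f = pCons a h" by (cases f)
  moreover from this f have "h \<in> monic_polys e"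
    by (auto simp: monic_polys_def split: if_splits)
  ultimately show "f \<in> (\<lambda>(a, h). pCons a h) ` (UNIV \<times> monic_polys e)" by auto
qed (auto simp: monic_polys_def)

text \<open>Write a monic polynomial as \<open>a + T h\<close> and expand binomially. Summing over
  the constant term \<open>a\<close> keeps only \<open>k < j\<close> with \<open>p ^ m - 1\<close>
  dividing \<open>j - k\<close>; Lucas' theorem keeps only the submasks.\<close>

lemma power_sum_Suc:
  assumes "prime p" "CARD('a::{field, finite}) = p ^ m"
  shows "(power_sum (Suc e) j :: 'a poly)
       = (\<Sum>k | step p m j k. monom (- of_nat (j choose k)) k * power_sum e k)"
proof -
  have pCons: "pCons a h ^ j = (\<Sum>k\<le>j. monom (of_nat (j choose k) * a ^ (j - k)) k * h ^ k)"
    for a :: 'a and h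
  proof -
    have "pCons a h ^ j = (monom 1 1 * h + [:a:]) ^ j" by (simp add: monom_Suc)
    also have "\<dots> = (\<Sum>k\<le>j. of_nat (j choose k) * (monom 1 1 * h) ^ k * [:a:] ^ (j - k))"
      by (rule binomial_ring)
    also have "\<dots> = (\<Sum>k\<le>j. monom (of_nat (j choose k) * a ^ (j - k)) k * h ^ k)"
    proof (intro sum.cong refl)
      fix k
      have "monom (of_nat (j choose k) * a ^ (j - k)) k = of_nat (j choose k) * [:a:] ^ (j - k) * monom 1 k"
        by (simp add: poly_const_pow of_nat_poly smult_monom)
      moreover have "(monom 1 1 * h) ^ k = monom 1 k * h ^ k"
        by (simp add: power_mult_distrib monom_power)
      ultimately show "of_nat (j choose k) * (monom 1 1 * h) ^ k * [:a:] ^ (j - k)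
          = monom (of_nat (j choose k) * a ^ (j - k)) k * h ^ k"
        by (simp only: mult_ac)
    qed
    finally show ?thesis .
  qed
  have inj: "inj_on (\<lambda>(a, h). pCons a h) (UNIV \<times> (monic_polys e :: 'a poly set))"
    by (rule inj_onI) auto
  have "(power_sum (Suc e) j :: 'a poly) = (\<Sum>a\<in>UNIV. \<Sum>h\<in>monic_polys e. pCons a h ^ j)"
    unfolding power_sum_def monic_polys_Suc sum.reindex[OF inj] sum.cartesian_product
    by (simp add: case_prod_unfold)
  also have "\<dots> = (\<Sum>a\<in>UNIV. \<Sum>k\<le>j. monom (of_nat (j choose k) * a ^ (j - k)) k * power_sum e k)"
    unfolding pCons power_sum_def sum_distrib_left by (intro sum.cong refl sum.swap)
  also have "\<dots> = (\<Sum>k\<le>j. monom (of_nat (j choose k) * (\<Sum>a\<in>UNIV. a ^ (j - k))) k * power_sum e k)"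
    by (subst sum.swap) (simp add: sum_distrib_left sum_distrib_right monom_sum)
  also have "\<dots> = (\<Sum>k | step p m j k. monom (of_nat (j choose k) * (\<Sum>a\<in>UNIV. a ^ (j - k))) k * power_sum e k)"
  proof (intro sum.mono_neutral_right ballI)
    fix k assume k: "k \<in> {..j} - {k. step p m j k}"
    have "(of_nat (j choose k) :: 'a) * (\<Sum>a\<in>UNIV. a ^ (j - k)) = 0"
      using k of_nat_binomial_neq_0_iff[OF assms(1) CHAR_eq_prime[OF assms], of j k]
      by (auto simp: sum_powers_field assms(2) step_def)
    thus "monom (of_nat (j choose k) * (\<Sum>a\<in>UNIV. a ^ (j - k))) k * (power_sum e k :: 'a poly) = 0"
      by simp
  qed (auto simp: step_def)
  also have "\<dots> = (\<Sum>k | step p m j k. monom (- of_nat (j choose k)) k * power_sum e k)"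
    by (intro sum.cong) (auto simp: sum_powers_field assms(2) step_def)
  finally show ?thesis .
qed

lemma finite_step: "finite {k. step p m j k}"
  by (rule finite_subset[of _ "{..j}"]) (auto simp: step_def)

lemma chains_Suc_Sigma:
  "chains p m (Suc e) j = (\<lambda>(k, ks). k # ks) ` (SIGMA k:{k. step p m j k}. chains p m e k)"
  by auto

lemma finite_chains: "finite (chains p m e j)"
proof (induction e arbitrary: j)
  case (Suc e)
  thus ?case unfolding chains_Suc_Sigma by (intro finite_imageI finite_SigmaI finite_step)
qed simp

text \<open>Iterates \<open>power_sum_Suc\<close>. The coefficients are products of negated binomial
  coefficients, each nonzero by Lucas' theorem.\<close>

lemma power_sum_chains:
  assumes "prime p" "CARD('a::{field, finite}) = p ^ m"
  shows "\<exists>c. (\<forall>ks\<in>chains p m e j. c ks \<noteq> 0)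
    \<and> (power_sum e j :: 'a poly) = (\<Sum>ks\<in>chains p m e j. monom (c ks) (sum_list ks))"
proof (induction e arbitrary: j)
  case 0
  show ?case by (intro exI[of _ "\<lambda>_. 1"]) (simp add: power_sum_def monic_polys_0)
next
  case (Suc e)
  define c where "c k = (SOME c. (\<forall>ks\<in>chains p m e k. c ks \<noteq> 0)
    \<and> (power_sum e k :: 'a poly) = (\<Sum>ks\<in>chains p m e k. monom (c ks) (sum_list ks)))" for k
  have c: "\<forall>ks\<in>chains p m e k. c k ks \<noteq> 0"
    "(power_sum e k :: 'a poly) = (\<Sum>ks\<in>chains p m e k. monom (c k ks) (sum_list ks))" for k
    using someI_ex[OF Suc.IH[of k]] unfolding c_def by blast+
  define c' where "c' ks = - of_nat (j choose hd ks) * c (hd ks) (tl ks)" for ks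
  have inj: "inj_on (\<lambda>(k, ks). k # ks) (SIGMA k:{k. step p m j k}. chains p m e k)"
    by (rule inj_onI) auto
  have "(power_sum (Suc e) j :: 'a poly)
      = (\<Sum>k | step p m j k. \<Sum>ks\<in>chains p m e k. monom (c' (k # ks)) (sum_list (k # ks)))"
    unfolding power_sum_Suc[OF assms] c(2) sum_distrib_left
    by (intro sum.cong) (auto simp: mult_monom c'_def)
  also have "\<dots> = (\<Sum>ks\<in>chains p m (Suc e) j. monom (c' ks) (sum_list ks))"
    unfolding chains_Suc_Sigma sum.reindex[OF inj]
    by (subst sum.Sigma) (auto simp: finite_step finite_chains case_prod_unfold)
  finally have "(power_sum (Suc e) j :: 'a poly) = (\<Sum>ks\<in>chains p m (Suc e) j. monom (c' ks) (sum_list ks))" .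
  moreover have "c' ks \<noteq> 0" if "ks \<in> chains p m (Suc e) j" for ks
    using that c(1) of_nat_binomial_neq_0_iff[OF assms(1) CHAR_eq_prime[OF assms], of j]
    by (auto simp: c'_def step_def)
  ultimately show ?case by blast
qed

text \<open>The monomial of uniquely maximal exponent cannot be cancelled.\<close>

lemma power_sum_neq_0:
  assumes "prime p" "CARD('a::{field, finite}) = p ^ m"
    and "ks0 \<in> chains p m e j"
    and "\<And>ks. ks \<in> chains p m e j \<Longrightarrow> ks \<noteq> ks0 \<Longrightarrow> sum_list ks < sum_list ks0"
  shows "(power_sum e j :: 'a poly) \<noteq> 0"
proof -
  obtain c :: "nat list \<Rightarrow> 'a" where c: "\<forall>ks\<in>chains p m e j. c ks \<noteq> 0"
    "power_sum e j = (\<Sum>ks\<in>chains p m e j. monom (c ks) (sum_list ks))"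
    using power_sum_chains[OF assms(1,2)] by blast
  have "coeff (power_sum e j) (sum_list ks0)
      = (\<Sum>ks\<in>chains p m e j. if ks = ks0 then c ks else 0)"
    unfolding c(2) coeff_sum using assms(4) by (intro sum.cong) fastforce+
  also have "\<dots> = c ks0" using assms(3) by (simp add: sum.delta finite_chains)
  finally show ?thesis using c(1) assms(3) by auto
qed

section \<open>Frobenius and the degree formula\<close>

lemma digit_sum_mult_p:
  assumes "2 \<le> p"
  shows "digit_sum p m i (p * x) = digit_sum p m (Suc i) x"
proof -
  have x: "x < p ^ x" using assms by (rule less_power_self)
  hence "p * x < p ^ Suc x" using assms by simp
  hence "digit_sum p m i (p * x) = (\<Sum>n<Suc x. digit p (p * x) n * p ^ ((n + i) mod m))"
    by (rule digit_sum_eq_sum[OF assms])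
  also have "\<dots> = (\<Sum>n<x. digit p x n * p ^ ((n + Suc i) mod m))"
    unfolding sum.lessThan_Suc_shift using assms by (simp add: digit_0 digit_Suc)
  finally show ?thesis by (simp add: digit_sum_def)
qed

lemma digit_sum_mult_power:
  assumes "2 \<le> p"
  shows "digit_sum p m i (p ^ l * x) = digit_sum p m (i + l) x"
proof (induction l arbitrary: i)
  case (Suc l)
  thus ?case using digit_sum_mult_p[OF assms, of m i "p ^ l * x"] by (simp add: mult.assoc)
qed simp

lemma digit_sum_mod: "digit_sum p m (i mod m) x = digit_sum p m i x"
  by (simp add: digit_sum_def mod_add_right_eq)

lemma power_sum_mult_power:
  assumes "prime p" "CARD('a::{field, finite}) = p ^ m"
  shows "(power_sum e (p ^ i * j) :: 'a poly) = power_sum e j ^ (p ^ i)"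
proof -
  have "(\<Sum>f\<in>monic_polys e. f ^ j) ^ (p ^ i) = (\<Sum>f\<in>monic_polys e. (f ^ j) ^ (p ^ i) :: 'a poly)"
    using CHAR_eq_prime[OF assms] assms(1) by (intro freshmans_dream_sum') auto
  thus ?thesis by (simp add: power_sum_def power_mult[symmetric] mult.commute)
qed

theorem degree_special_poly:
  assumes "prime p" "CARD('a::{field, finite}) = p ^ m" "0 < m"
  shows "degree (special_poly j :: 'a poly poly)
       = Min ((\<lambda>i. digit_sum p m i j div (p ^ m - 1)) ` {..<m})"
proof -
  have p: "2 \<le> p" using assms(1) by (rule prime_ge_2_nat)
  define q where "q = p ^ m - 1"
  have "p \<le> p ^ m" using p assms(3) by (intro self_le_power) auto
  hence q: "0 < q" using p by (simp add: q_def)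
  define E where "E = Min ((\<lambda>i. digit_sum p m i j div q) ` {..<m})"
  have "E \<in> (\<lambda>i. digit_sum p m i j div q) ` {..<m}"
    unfolding E_def using assms(3) by (intro Min_in) auto
  then obtain i where i: "i < m" "E = digit_sum p m i j div q" by auto
  have ge: "E * q \<le> digit_sum p m l j" for l
  proof -
    have "E \<le> digit_sum p m (l mod m) j div q"
      unfolding E_def using assms(3) by (intro Min_le) auto
    hence "E * q \<le> digit_sum p m l j div q * q" by (simp add: digit_sum_mod)
    thus ?thesis using div_times_less_eq_dividend le_trans by blast
  qed
  \<comment> \<open>Multiplication by \<open>p ^ i\<close> rotates the minimising digit sum to index
    \<open>0\<close>, where \<open>unique_maximal_chain\<close> asks for the upper bound.\<close>
  have "\<exists>ks0\<in>chains p m E (p ^ i * j). \<forall>ks\<in>chains p m E (p ^ i * j). ks \<noteq> ks0 \<longrightarrow> sum_list ks < sum_list ks0"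
  proof (rule unique_maximal_chain[OF p assms(3)])
    show "E * (p ^ m - 1) \<le> digit_sum p m l (p ^ i * j)" for l
      using ge by (simp add: digit_sum_mult_power[OF p] q_def)
    show "digit_sum p m 0 (p ^ i * j) < Suc E * (p ^ m - 1)"
      using dividend_less_div_times[OF q, of "digit_sum p m i j"] i(2)
      by (simp add: digit_sum_mult_power[OF p] q_def add.commute)
  qed
  hence "(power_sum E (p ^ i * j) :: 'a poly) \<noteq> 0"
    using power_sum_neq_0[OF assms(1,2)] by blast
  hence "(power_sum E j :: 'a poly) \<noteq> 0"
    using p by (simp add: power_sum_mult_power[OF assms(1,2)])
  hence "E \<le> degree (special_poly j :: 'a poly poly)"
    by (intro le_degree) (simp add: coeff_special_poly)
  moreover have "degree (special_poly j :: 'a poly poly) \<le> E"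
  proof (rule degree_le, intro allI impI)
    fix e assume e: "E < e"
    have "chains p m e j = {}"
    proof (rule ccontr)
      assume "chains p m e j \<noteq> {}"
      hence "e * q \<le> digit_sum p m i j" unfolding q_def by (rule chains_digit_sum_ge[OF p])
      hence "e \<le> digit_sum p m i j div q" using q by (simp add: less_eq_div_iff_mult_less_eq)
      thus False using e i(2) by simp
    qed
    thus "coeff (special_poly j :: 'a poly poly) e = 0"
      using power_sum_chains[OF assms(1,2), of e j] by (auto simp: coeff_special_poly)
  qed
  ultimately show ?thesis by (simp add: E_def q_def)
qed

section \<open>Invariance under digit permutations\<close>

lemma digit_sum_0: "digit_sum p m i 0 = 0"
  by (simp add: digit_sum_def)

text \<open>The digits of \<open>y\<close> move up by \<open>m\<close> places, which leaves their
  positions modulo \<open>m\<close> unchanged.\<close>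

lemma digit_sum_add_mult:
  assumes "2 \<le> p" "c < p ^ m"
  shows "digit_sum p m i (c + p ^ m * y) = digit_sum p m i c + digit_sum p m i y"
proof -
  have y: "y < p ^ y" using assms(1) by (rule less_power_self)
  have "c + p ^ m * y < p ^ m * (y + 1)" using assms(2) by simp
  also have "\<dots> \<le> p ^ m * p ^ y" using y by (intro mult_le_mono2) simp
  finally have less: "c + p ^ m * y < p ^ (m + y)" by (simp add: power_add)
  have low: "digit p (c + p ^ m * y) n = digit p c n" if "n < m" for n
  proof -
    have "p ^ m = p ^ n * (p * p ^ (m - Suc n))"
      using that by (simp flip: power_add power_Suc)
    hence "(c + p ^ m * y) div p ^ n = (c + p ^ n * (p * (p ^ (m - Suc n) * y))) div p ^ n"
      by (simp only: mult.assoc)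
    also have "\<dots> = c div p ^ n + p * (p ^ (m - Suc n) * y)" using assms(1) by simp
    finally show ?thesis by (simp add: digit_def)
  qed
  have high: "digit p (c + p ^ m * y) (m + n) = digit p y n" for n
    using assms by (simp add: digit_def power_add div_mult2_eq)
  have split: "(\<Sum>n<m + k. f n) = (\<Sum>n<m. f n) + (\<Sum>n<k. f (m + n))" for f :: "nat \<Rightarrow> nat" and k
    by (induction k) simp_all
  have "digit_sum p m i (c + p ^ m * y)
      = (\<Sum>n<m + y. digit p (c + p ^ m * y) n * p ^ ((n + i) mod m))"
    by (rule digit_sum_eq_sum[OF assms(1) less])
  also have "\<dots> = (\<Sum>n<m. digit p (c + p ^ m * y) n * p ^ ((n + i) mod m))
      + (\<Sum>n<y. digit p (c + p ^ m * y) (m + n) * p ^ ((m + n + i) mod m))"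
    by (rule split)
  also have "(\<Sum>n<m. digit p (c + p ^ m * y) n * p ^ ((n + i) mod m)) = digit_sum p m i c"
    unfolding digit_sum_eq_sum[OF assms] using low by (intro sum.cong) auto
  also have "(\<Sum>n<y. digit p (c + p ^ m * y) (m + n) * p ^ ((m + n + i) mod m)) = digit_sum p m i y"
    unfolding digit_sum_def using high by (intro sum.cong) (auto simp: add.assoc)
  finally show ?thesis .
qed

lemma digit_sum_blocks:
  assumes "2 \<le> p" "\<And>l. l < R \<Longrightarrow> g l < p ^ m"
  shows "digit_sum p m i (\<Sum>l<R. g l * (p ^ m) ^ l) = (\<Sum>l<R. digit_sum p m i (g l))"
  using assms(2)
proof (induction R arbitrary: g)
  case (Suc R)
  have "(\<Sum>l<Suc R. g l * (p ^ m) ^ l) = g 0 + p ^ m * (\<Sum>l<R. g (Suc l) * (p ^ m) ^ l)"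
    unfolding sum.lessThan_Suc_shift by (simp add: sum_distrib_left mult.left_commute)
  thus ?case using Suc.IH[of "\<lambda>l. g (Suc l)"] Suc.prems digit_sum_add_mult[OF assms(1), of "g 0"]
    by (simp add: sum.lessThan_Suc_shift del: sum.lessThan_Suc)
qed (simp add: digit_sum_0)

text \<open>By \<open>digit_sum_blocks\<close> the contribution of a base-\<open>p ^ m\<close> digit
  does not depend on its place, so rearranging these digits has no effect.\<close>

lemma digit_sum_permute:
  assumes "2 \<le> p" "0 < m" "inj \<rho>"
  shows "digit_sum p m i (\<Sum>l\<le>j. (j div (p ^ m) ^ l mod p ^ m) * (p ^ m) ^ \<rho> l) = digit_sum p m i j"
proof -
  define q where "q = p ^ m"
  have "p \<le> q" unfolding q_def using assms by (intro self_le_power) auto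
  hence q: "2 \<le> q" using assms(1) by simp
  define c where "c l = j div q ^ l mod q" for l
  have c: "c l < q" for l using q by (simp add: c_def)
  define R where "R = Suc (Max (\<rho> ` {..j}))"
  have R: "\<rho> l < R" if "l \<le> j" for l
    unfolding R_def less_Suc_eq_le using that by (intro Max_ge) auto
  \<comment> \<open>The permuted digits, filled up with zeros at the places below \<open>R\<close>
    that receive no digit of index at most \<open>j\<close>.\<close>
  define g where "g l = (if l \<in> \<rho> ` {..j} then c (inv \<rho> l) else 0)" for l
  have inj: "inj_on \<rho> {..j}" using assms(3) by (rule inj_on_subset) simp
  have reindex: "(\<Sum>l<R. f l (g l)) = (\<Sum>l\<le>j. f (\<rho> l) (c l))" if "\<And>l. f l 0 = 0" for f :: "nat \<Rightarrow> nat \<Rightarrow> nat"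
  proof -
    have "(\<Sum>l<R. f l (g l)) = (\<Sum>l\<in>\<rho> ` {..j}. f l (g l))"
      using R that by (intro sum.mono_neutral_right) (auto simp: g_def)
    also have "\<dots> = (\<Sum>l\<le>j. f (\<rho> l) (c l))"
      unfolding sum.reindex[OF inj] by (intro sum.cong) (auto simp: g_def assms(3))
    finally show ?thesis .
  qed
  have "(\<Sum>l\<le>j. c l * q ^ \<rho> l) = (\<Sum>l<R. g l * q ^ l)"
    using reindex[of "\<lambda>l x. x * q ^ l"] by simp
  also have "digit_sum p m i \<dots> = (\<Sum>l<R. digit_sum p m i (g l))"
    unfolding q_def using c q by (intro digit_sum_blocks[OF assms(1)]) (use assms(1) in \<open>auto simp: g_def q_def\<close>)
  also have "\<dots> = (\<Sum>l\<le>j. digit_sum p m i (c l))"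
    using reindex[of "\<lambda>l x. digit_sum p m i x"] by (simp add: digit_sum_0)
  also have "\<dots> = digit_sum p m i (\<Sum>l<Suc j. c l * q ^ l)"
    unfolding q_def using c
    by (subst digit_sum_blocks[OF assms(1)]) (auto simp: q_def lessThan_Suc_atMost)
  \<comment> \<open>Since \<open>j < q ^ j\<close>, the digits of index at most \<open>j\<close>
    represent \<open>j\<close> completely.\<close>
  also have "(\<Sum>l<Suc j. c l * q ^ l) = j"
    using digit_expansion_nat[of j q "Suc j"] less_power_self[OF q, of j] q
    unfolding c_def by (simp add: less_imp_le_nat order_less_le_trans[of j "q ^ j"] del: sum.lessThan_Suc)
  finally show ?thesis by (simp add: c_def q_def)
qed

theorem corollary4:
  fixes p q m j :: nat
    and \<sigma> :: "(nat \<Rightarrow> nat) \<Rightarrow> (nat \<Rightarrow> nat)"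
  assumes "prime p" and "q = p ^ m"
    and "CARD('a::{field, finite}) = q"
    and "\<sigma> \<in> digit_perms p q"
  shows "degree (special_poly j :: 'a poly poly)
       = degree (special_poly (nat_action p \<sigma> j) :: 'a poly poly)"
proof -
  have card: "CARD('a) = p ^ m" using assms(2,3) by simp
  \<comment> \<open>The elements \<open>0\<close> and \<open>1\<close> are distinct, so the field
    has more than one element and \<open>m = 0\<close> is excluded.\<close>
  have "card {0 :: 'a, 1} \<le> CARD('a)" by (intro card_mono) auto
  hence q: "1 < q" using assms(3) by simp
  hence m: "0 < m" using assms(2) by (cases m) auto
  obtain \<rho> where \<rho>: "bij \<rho>" "\<sigma> = digit_perm p q \<rho>" using assms(4) by (auto simp: digit_perms_def)
  have inj: "inj \<rho>" using \<rho>(1) by (rule bij_is_inj)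
  have "digit_sum p m i (nat_action p \<sigma> j) = digit_sum p m i j" for i
    unfolding \<rho>(2) nat_action_digit_perm[OF assms(1,2) q inj]
    unfolding assms(2) by (rule digit_sum_permute[OF prime_ge_2_nat[OF assms(1)] m inj])
  thus ?thesis by (simp add: degree_special_poly[OF assms(1) card m])
qed

end
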